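(* For $\tau\in\mathbb{H}$, the function $\Phi=\Phi_1+\Phi_2$ (defined in the context) satisfies $$\Phi(\tau) = \frac{1}{\pi} \int_\tau^{\tau +i\infty} \left(\ {}_{*}\!\!\int_{\tau}^{w_1} \frac{\left( 4f_0(\bm w)+g_0(\bm w)\right) \left( 1-\frac{\pi i}6(w_2-\tau)E_2(\tau)\right)}{ (i(w_2-\tau))^{\frac 32}}\, dw_2\right) \frac{dw_1}{\sqrt{i(w_1-\tau)}} ,$$ where $$f_0 (\bm w) := \vartheta_{3,1}^{[1]} (w_1) \vartheta_{3,2}^{[1]} (w_2) - \vartheta_{3,2}^{[1]} (w_1) \vartheta_{3,1}^{[1]} (w_2),\qquad g_0 (\bm w) :=\vartheta_{\frac32,1}^{[1]} (w_1) \vartheta_{\frac32,0}^{[1]} (w_2) -\vartheta_{\frac32,0}^{[1]} (w_1) \vartheta_{\frac32,1}^{[1]} (w_2).$$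
   Context: $\mathbb{H}$ is the upper half-plane, $q=e^{2\pi i\tau}$, $\bm w=(w_1,w_2)$, $\mathrm{sgn}(x)=x/|x|$ for $x\neq0$, $\mathrm{sgn}(0)=0$, $E_2(\tau)=1-24\sum_{n\ge1}\sum_{d\mid n}d\,q^n$. With $Q_B(\bm n):=\frac32n_1^2+3n_1n_2+3n_2^2$, $$\Phi_1 (\tau) :=\sum_{\bm n\in\mathbb{Z}^2+\left(\frac 13,\frac 16\right)} (-1)^{n_1-\frac 13}\left( \mathrm{sgn}(n_2) + \mathrm{sgn} (n_1 + n_2) \right) \mathrm{sgn}(n_1) \left( ( n_1+2n_2 )^2 - \frac{E_2 (\tau)}{18} \right)q^{Q_B(\bm n)},$$ $$\Phi_2 (\tau) :=\sum_{\bm n\in\mathbb{Z}^2+\left(\frac 13,\frac 16\right)} (-1)^{n_1-\frac 13}\,\mathrm{sgn} (n_1+n_2)\, \mathrm{sgn} (n_2)\, n_1(n_1+2n_2)\,q^{Q_B(\bm n)} .$$ For $k\in\mathbb{N}_0$: $\vartheta_{m,r}^{[k]}(\tau)=\sum_{n\in\mathbb{Z}+\frac{r}{2m}}n^k q^{mn^2}$ if $m\in\mathbb{Z}_{>0}$, and $\vartheta_{m,r}^{[k]}(\tau)=\sum_{n\in\mathbb{Z}+\frac{r}{2m}+\frac12}(-1)^{n-\frac{r+m}{2m}}n^kq^{mn^2}$ if $m\in\mathbb{Z}_{\geq0}+\frac12$. Square roots are principal and $(x)^{3/2}=(\sqrt{x})^3$. The outer integral is along the vertical path from $\tau$ to $i\infty$.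 For $w_1\in\mathbb{H}\setminus\{\tau\}$ the regularized integral is $${}_{*}\!\!\int_{\tau}^{w_1} \frac{f(w_2)}{(i (w_2-\tau))^{\frac{3}{2}}}\, dw_2 := \lim_{\mathfrak z \to \tau} \left(\int_{\mathfrak z}^{w_1} \frac{f(w_2)}{(i (w_2-\tau))^{\frac{3}{2}}}\, dw_2+ 2 i\, \frac{f(\tau)}{\sqrt{i(\mathfrak z-\tau)}}\right),$$ with integral and one-sided limit along the hyperbolic geodesic from $\tau$ to $w_1$. *)

theory Defs
  imports "HOL-Complex_Analysis.Complex_Analysis"
begin

definition qexp :: "complex \<Rightarrow> real \<Rightarrow> complex"
  where "qexp \<tau> x = exp (2 * of_real pi * \<i> * of_real x * \<tau>)"  \<comment> \<open>the power q^x\<close>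

definition E2 :: "complex \<Rightarrow> complex"
  where "E2 \<tau> = 1 - 24 * (\<Sum>\<^sub>\<infinity>n\<in>{1::nat..}. of_nat (\<Sum>d | d dvd n. d) * qexp \<tau> (real n))"

definition QB :: "real \<Rightarrow> real \<Rightarrow> real"
  where "QB n1 n2 = 3/2 * n1^2 + 3 * n1 * n2 + 3 * n2^2"

text \<open>Sums over a shifted lattice are indexed by the underlying integer vector:
  below, \<open>n1 = a + 1/3\<close> and \<open>n2 = b + 1/6\<close> with integers \<open>a\<close>, \<open>b\<close>.\<close>

definition Phi1 :: "complex \<Rightarrow> complex"
  where "Phi1 \<tau> = (\<Sum>\<^sub>\<infinity>(a, b)\<in>(UNIV :: (int \<times> int) set).
    let n1 = real_of_int a + 1/3; n2 = real_of_int b + 1/6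
    in (-1) powi a * of_real ((sgn n2 + sgn (n1 + n2)) * sgn n1)
         * (of_real ((n1 + 2 * n2)^2) - E2 \<tau> / 18) * qexp \<tau> (QB n1 n2))"

definition Phi2 :: "complex \<Rightarrow> complex"
  where "Phi2 \<tau> = (\<Sum>\<^sub>\<infinity>(a, b)\<in>(UNIV :: (int \<times> int) set).
    let n1 = real_of_int a + 1/3; n2 = real_of_int b + 1/6
    in (-1) powi a * of_real (sgn (n1 + n2) * sgn n2 * n1 * (n1 + 2 * n2)) * qexp \<tau> (QB n1 n2))"

definition Phi :: "complex \<Rightarrow> complex"
  where "Phi \<tau> = Phi1 \<tau> + Phi2 \<tau>"

text \<open>\<open>theta k m r\<close> is intended for \<open>m\<close> a positive integer (first case) or a nonnegative
  integer plus 1/2 (second case). In the second case \<open>n = j + r/(2m) + 1/2\<close>, so that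
  \<open>j = n - (r+m)/(2m)\<close>.\<close>

definition theta :: "nat \<Rightarrow> real \<Rightarrow> int \<Rightarrow> complex \<Rightarrow> complex"
  where "theta k m r \<tau> =
    (if m \<in> \<int> then
       (\<Sum>\<^sub>\<infinity>j\<in>(UNIV :: int set).
          let n = of_int j + of_int r / (2 * m)
          in of_real (n^k) * qexp \<tau> (m * n^2))
     else
       (\<Sum>\<^sub>\<infinity>j\<in>(UNIV :: int set).
          let n = of_int j + of_int r / (2 * m) + 1/2
          in (-1) powi j * of_real (n^k) * qexp \<tau> (m * n^2)))"

definition f0 :: "complex \<Rightarrow> complex \<Rightarrow> complex"
  where "f0 w1 w2 = theta 1 3 1 w1 * theta 1 3 2 w2 - theta 1 3 2 w1 * theta 1 3 1 w2"

definition g0 :: "complex \<Rightarrow> complex \<Rightarrow> complex"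
  where "g0 w1 w2 = theta 1 (3/2) 1 w1 * theta 1 (3/2) 0 w2
                  - theta 1 (3/2) 0 w1 * theta 1 (3/2) 1 w2"

text \<open>The hyperbolic geodesic segment from \<open>a\<close> to \<open>b\<close> in the upper half-plane: a vertical
  segment, or an arc of the circle through \<open>a\<close> and \<open>b\<close> centred at the real point \<open>c\<close>.\<close>

definition geodesic :: "complex \<Rightarrow> complex \<Rightarrow> real \<Rightarrow> complex"
  where "geodesic a b =
    (if Re a = Re b then linepath a b
     else let c = ((cmod b)^2 - (cmod a)^2) / (2 * (Re b - Re a))
          in part_circlepath (of_real c) (cmod (a - of_real c))
               (Arg (a - of_real c)) (Arg (b - of_real c)))"

text \<open>The regularized integral from \<open>\<tau>\<close> to \<open>w1\<close>. For \<open>z\<close> on the geodesic from \<open>\<tau>\<close> to \<open>w1\<close>,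
  \<open>geodesic z w1\<close> is the part of that geodesic between \<open>z\<close> and \<open>w1\<close>. On vertical geodesics
  \<open>\<i> * (w - \<tau>)\<close> is a negative real, where \<open>csqrt\<close> takes its value in the upper
  half-plane (argument \<open>pi\<close>).\<close>

definition reg_integrand :: "complex \<Rightarrow> (complex \<Rightarrow> complex) \<Rightarrow> complex \<Rightarrow> complex"
  where "reg_integrand \<tau> f w2 = f w2 / csqrt (\<i> * (w2 - \<tau>)) ^ 3"

definition reg_approx ::
    "complex \<Rightarrow> (complex \<Rightarrow> complex) \<Rightarrow> complex \<Rightarrow> complex \<Rightarrow> complex"
  where "reg_approx \<tau> f w1 z =
    contour_integral (geodesic z w1) (reg_integrand \<tau> f) + 2 * \<i> * f \<tau> / csqrt (\<i> * (z - \<tau>))"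

definition reg_integral :: "complex \<Rightarrow> (complex \<Rightarrow> complex) \<Rightarrow> complex \<Rightarrow> complex"
  where "reg_integral \<tau> f w1 =
    Lim (at \<tau> within path_image (geodesic \<tau> w1)) (reg_approx \<tau> f w1)"

text \<open>Existence of the regularized integral: every truncated integral and the limit exist.\<close>

definition reg_integrable :: "complex \<Rightarrow> (complex \<Rightarrow> complex) \<Rightarrow> complex \<Rightarrow> bool"
  where "reg_integrable \<tau> f w1 \<longleftrightarrow>
    (\<forall>z \<in> path_image (geodesic \<tau> w1) - {\<tau>}.
        reg_integrand \<tau> f contour_integrable_on geodesic z w1) \<and>
    (\<exists>L. (reg_approx \<tau> f w1 \<longlongrightarrow> L) (at \<tau> within path_image (geodesic \<tau> w1)))"

text \<open>Integration along the vertical ray from \<open>\<tau>\<close> to \<open>\<tau> + \<i>\<infinity>\<close>, parametrized by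
  \<open>w = \<tau> + \<i> t\<close>, \<open>dw = \<i> dt\<close>.\<close>

definition vertical_integral :: "complex \<Rightarrow> (complex \<Rightarrow> complex) \<Rightarrow> complex"
  where "vertical_integral \<tau> h = (LBINT t:{0<..}. h (\<tau> + \<i> * of_real t) * \<i>)"

definition vertical_integrable :: "complex \<Rightarrow> (complex \<Rightarrow> complex) \<Rightarrow> bool"
  where "vertical_integrable \<tau> h \<longleftrightarrow>
    set_integrable lborel {0<..} (\<lambda>t. h (\<tau> + \<i> * of_real t) * \<i>)"

definition inner_fun :: "complex \<Rightarrow> complex \<Rightarrow> complex \<Rightarrow> complex"
  where "inner_fun \<tau> w1 w2 =
    (4 * f0 w1 w2 + g0 w1 w2) * (1 - of_real pi * \<i> / 6 * (w2 - \<tau>) * E2 \<tau>)"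

definition outer_fun :: "complex \<Rightarrow> complex \<Rightarrow> complex"
  where "outer_fun \<tau> w1 = reg_integral \<tau> (inner_fun \<tau> w1) w1 / csqrt (\<i> * (w1 - \<tau>))"

end

theory Submission
  imports Defs "HOL-Real_Asymp.Real_Asymp"
begin

text \<open>On the ray \<open>w\<^sub>1 = \<tau> + i t\<close>, \<open>w\<^sub>2 = \<tau> + i s\<close> the numerator of the integrand is
  \<open>F(t, s) (1 + c s)\<close> with \<open>c = \<pi> E\<^sub>2 / 6\<close> and \<open>F\<close> antisymmetric. As \<open>F(t, t) = 0\<close>, integration
  by parts turns the regularized integral into a convergent one, and the double integral can be
  evaluated termwise on the theta series:
  \<open>\<integral>\<^sub>0\<^sup>\<infinity> \<integral>\<^sub>0\<^sup>t exp (- \<alpha> t - \<beta> s) / sqrt (s t) ds dt = 2 arctan (sqrt (\<beta> / \<alpha>)) / sqrt (\<alpha> \<beta>)\<close>.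
  So the right hand side is a sum over a planar lattice of quadratic weights times angles.
  In the coordinates \<open>u = n\<^sub>1 + n\<^sub>2\<close>, \<open>v = n\<^sub>2\<close> one has \<open>Q\<^sub>B = 3/2 (u\<^sup>2 + v\<^sup>2)\<close>; the part coming from \<open>g\<^sub>0\<close>
  measures angles from the axes and the part coming from \<open>f\<^sub>0\<close> from the diagonals, so after
  antisymmetrizing under \<open>u \<mapsto> - u\<close> the angles cancel up to multiples of \<open>\<pi> / 4\<close>, which gives the
  sign functions in \<open>\<Phi>\<close>.\<close>

section \<open>Series of exponentials\<close>

text \<open>Unordered sums over a countable index type become ordinary series here, so that the
  theorems on \<open>sums\<close> and \<open>suminf\<close> (termwise integration, differentiation
  of series) reach sums over \<open>int\<close> and \<open>int \<times> int\<close>.\<close>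

lemma infsum_nat_enumeration:
  fixes f :: "'a::countable \<Rightarrow> 'b::banach" and e :: "nat \<Rightarrow> 'a"
  assumes "bij e" and "(\<lambda>k. norm (f k)) summable_on UNIV"
  shows "summable (\<lambda>n. norm (f (e n)))" "(\<lambda>n. f (e n)) sums (\<Sum>\<^sub>\<infinity>k. f k)"
proof -
  have 1: "(\<lambda>n. norm (f (e n))) summable_on UNIV"
    using summable_on_reindex_bij_betw[of e UNIV UNIV "\<lambda>k. norm (f k)"] assms by simp
  then show "summable (\<lambda>n. norm (f (e n)))"
    by (rule summable_on_imp_summable)
  have "((\<lambda>n. f (e n)) has_sum (\<Sum>\<^sub>\<infinity>n. f (e n))) UNIV"
    by (rule has_sum_infsum[OF abs_summable_summable[OF 1]])
  moreover have "(\<Sum>\<^sub>\<infinity>n. f (e n)) = (\<Sum>\<^sub>\<infinity>k. f k)"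
    using infsum_reindex_bij_betw[of e UNIV UNIV f] assms by simp
  ultimately show "(\<lambda>n. f (e n)) sums (\<Sum>\<^sub>\<infinity>k. f k)"
    using has_sum_imp_sums by metis
qed

text \<open>Dominated convergence along an enumeration of the index type: the summable integrals of
  the norms control all partial sums. Infinitude of the type makes the enumeration by
  \<open>nat\<close> a bijection.\<close>

lemma integral_infsum:
  fixes f :: "'a::countable \<Rightarrow> 'b \<Rightarrow> complex"
  assumes inf: "infinite (UNIV :: 'a set)"
    and int: "\<And>k. integrable M (f k)"
    and summ: "\<And>x. (\<lambda>k. norm (f k x)) summable_on UNIV"
    and norms: "(\<lambda>k. \<integral>x. norm (f k x) \<partial>M) summable_on UNIV"
  shows "integrable M (\<lambda>x. \<Sum>\<^sub>\<infinity>k. f k x)"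
    and "(\<integral>x. (\<Sum>\<^sub>\<infinity>k. f k x) \<partial>M) = (\<Sum>\<^sub>\<infinity>k. \<integral>x. f k x \<partial>M)"
proof -
  define e :: "nat \<Rightarrow> 'a" where "e = from_nat_into UNIV"
  have e: "bij e"
    unfolding e_def by (rule bij_betw_from_nat_into) (auto simp: inf)
  have eq: "(\<lambda>x. \<Sum>\<^sub>\<infinity>k. f k x) = (\<lambda>x. \<Sum>n. f (e n) x)"
    using infsum_nat_enumeration(2)[OF e summ] by (simp add: sums_iff)
  have AE: "AE x in M. summable (\<lambda>n. norm (f (e n) x))"
    using infsum_nat_enumeration(1)[OF e summ] by simp
  have sm: "summable (\<lambda>n. \<integral>x. norm (f (e n) x) \<partial>M)"
    using infsum_nat_enumeration(1)[OF e, of "\<lambda>k. \<integral>x. norm (f k x) \<partial>M"] norms by simp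
  show "integrable M (\<lambda>x. \<Sum>\<^sub>\<infinity>k. f k x)"
    unfolding eq using int AE sm by (intro integrable_suminf) auto
  have "(\<lambda>k. norm (\<integral>x. f k x \<partial>M)) summable_on UNIV"
    by (rule summable_on_comparison_test[OF norms]) (auto intro: integral_norm_bound)
  from infsum_nat_enumeration(2)[OF e this]
  have "(\<Sum>\<^sub>\<infinity>k. \<integral>x. f k x \<partial>M) = (\<Sum>n. \<integral>x. f (e n) x \<partial>M)"
    by (simp add: sums_iff)
  then show "(\<integral>x. (\<Sum>\<^sub>\<infinity>k. f k x) \<partial>M) = (\<Sum>\<^sub>\<infinity>k. \<integral>x. f k x \<partial>M)"
    unfolding eq using integral_suminf[of M "\<lambda>n. f (e n)", OF int AE sm] by simp
qed

lemma continuous_on_infsum: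
  fixes f :: "'a \<Rightarrow> 'b::topological_space \<Rightarrow> 'c::banach"
  assumes "\<And>k. continuous_on Y (f k)"
    and "\<And>k y. y \<in> Y \<Longrightarrow> norm (f k y) \<le> M k" and "M summable_on UNIV"
  shows "continuous_on Y (\<lambda>y. \<Sum>\<^sub>\<infinity>k. f k y)"
proof (rule uniform_limit_theorem)
  show "\<forall>\<^sub>F X in finite_subsets_at_top UNIV. continuous_on Y (\<lambda>y. \<Sum>k\<in>X. f k y)"
    using assms(1) by (intro always_eventually allI continuous_on_sum) auto
  show "uniform_limit Y (\<lambda>X y. \<Sum>k\<in>X. f k y) (\<lambda>y. \<Sum>\<^sub>\<infinity>k. f k y) (finite_subsets_at_top UNIV)"
    using assms by (intro Weierstrass_m_test_general) auto
qed auto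

text \<open>The series is differentiated as a function of a complex variable on the closed
  half-plane of nonnegative real part. There every exponential has norm at most 1, so
  \<open>norm (d k) * \<delta> k\<close> is a majorant for the derivatives. Restriction to the real
  axis gives the derivative, one-sided at 0.\<close>

lemma has_vector_derivative_infsum_exp:
  fixes d :: "'a::countable \<Rightarrow> complex" and \<delta> :: "'a \<Rightarrow> real"
  assumes inf: "infinite (UNIV :: 'a set)"
    and \<delta>: "\<And>k. 0 \<le> \<delta> k"
    and d: "(\<lambda>k. norm (d k)) summable_on UNIV" and d': "(\<lambda>k. norm (d k) * \<delta> k) summable_on UNIV"
    and s: "0 \<le> s"
  shows "((\<lambda>s. \<Sum>\<^sub>\<infinity>k. d k * of_real (exp (- \<delta> k * s))) has_vector_derivative
          (\<Sum>\<^sub>\<infinity>k. - (d k * of_real (\<delta> k)) * of_real (exp (- \<delta> k * s)))) (at s within {0..})"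
proof -
  define S where "S = {z::complex. 0 \<le> Re z}"
  define e :: "nat \<Rightarrow> 'a" where "e = from_nat_into UNIV"
  have e: "bij e"
    unfolding e_def by (rule bij_betw_from_nat_into) (auto simp: inf)
  define f where "f k z = d k * exp (- of_real (\<delta> k) * z)" for k z
  define f' where "f' k z = - (d k * of_real (\<delta> k)) * exp (- of_real (\<delta> k) * z)" for k z
  have le1: "norm (exp (- of_real (\<delta> k) * z)) \<le> 1" if "z \<in> S" for k z
    using that \<delta>[of k] by (simp add: S_def)
  have nf: "norm (f k z) \<le> norm (d k)" if "z \<in> S" for k z
    using mult_left_mono[OF le1[OF that, of k] norm_ge_zero[of "d k"]] unfolding f_def norm_mult by simp
  have nf': "norm (f' k z) \<le> norm (d k) * \<delta> k" if "z \<in> S" for k z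
    using mult_left_mono[OF le1[OF that, of k], of "norm (d k) * \<delta> k"] \<delta>[of k]
    unfolding f'_def norm_mult norm_minus_cancel by (simp add: mult.assoc)
  have sf: "(\<lambda>n. f (e n) z) sums (\<Sum>\<^sub>\<infinity>k. f k z)" if "z \<in> S" for z
    by (rule infsum_nat_enumeration(2)[OF e summable_on_comparison_test[OF d]])
       (use nf that in auto)
  have sf': "(\<lambda>n. f' (e n) z) sums (\<Sum>\<^sub>\<infinity>k. f' k z)" if "z \<in> S" for z
    by (rule infsum_nat_enumeration(2)[OF e summable_on_comparison_test[OF d']])
       (use nf' that in auto)
  have sd': "summable (\<lambda>n. norm (d (e n)) * \<delta> (e n))"
    using infsum_nat_enumeration(1)[OF e, of "\<lambda>k. norm (d k) * \<delta> k"] d' \<delta> by (simp add: abs_mult)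
  have "uniform_limit S (\<lambda>n z. \<Sum>i<n. f' (e i) z) (\<lambda>z. \<Sum>n. f' (e n) z) sequentially"
    by (rule Weierstrass_m_test[OF _ sd']) (use nf' in auto)
  moreover have "convex S" unfolding S_def by (rule convex_halfspace_Re_ge)
  moreover have "(f (e n) has_field_derivative f' (e n) z) (at z within S)" for n z
    unfolding f_def f'_def by (auto intro!: derivative_eq_intros)
  moreover have "of_real s \<in> S" "summable (\<lambda>n. f (e n) (of_real s))"
    using s sums_summable[OF sf[of "of_real s"]] by (auto simp: S_def)
  ultimately obtain g where g: "\<And>z. z \<in> S \<Longrightarrow> (\<lambda>n. f (e n) z) sums g z"
     "\<And>z. z \<in> S \<Longrightarrow> (g has_field_derivative (\<Sum>n. f' (e n) z)) (at z within S)"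
    using has_field_derivative_series[of S "\<lambda>n. f (e n)" "\<lambda>n. f' (e n)"
      "\<lambda>z. \<Sum>n. f' (e n) z" "of_real s"] by blast
  have geq: "g z = (\<Sum>\<^sub>\<infinity>k. f k z)" if "z \<in> S" for z
    using g(1)[OF that] sf[OF that] sums_unique2 by blast
  have "((g \<circ> of_real) has_vector_derivative 1 * (\<Sum>n. f' (e n) (of_real s))) (at s within {0..})"
  proof (rule field_vector_diff_chain_within)
    show "(of_real has_vector_derivative 1) (at s within {0..})"
      using bounded_linear_imp_has_derivative[OF bounded_linear_of_real]
      by (simp add: has_vector_derivative_def scaleR_conv_of_real)
    have "of_real ` {0..} \<subseteq> S" by (auto simp: S_def)
    then show "(g has_field_derivative (\<Sum>n. f' (e n) (of_real s))) (at (of_real s) within of_real ` {0..})"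
      using g(2)[OF \<open>of_real s \<in> S\<close>] has_field_derivative_subset by blast
  qed
  moreover have "(\<Sum>n. f' (e n) (of_real s)) = (\<Sum>\<^sub>\<infinity>k. f' k (of_real s))"
    using sf'[OF \<open>of_real s \<in> S\<close>] by (simp add: sums_iff)
  moreover have "(g \<circ> of_real) x = (\<Sum>\<^sub>\<infinity>k. d k * of_real (exp (- \<delta> k * x)))" if "x \<in> {0..}" for x
    using that by (simp add: geq S_def f_def flip: exp_of_real)
  ultimately have "((\<lambda>s. \<Sum>\<^sub>\<infinity>k. d k * of_real (exp (- \<delta> k * s))) has_vector_derivative
      (\<Sum>\<^sub>\<infinity>k. f' k (of_real s))) (at s within {0..})"
    using s has_vector_derivative_transform[of s "{0..}" _ "g \<circ> of_real"] by simp
  then show ?thesis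
    by (simp add: f'_def flip: exp_of_real)
qed

section \<open>The regularized integral on a vertical ray\<close>

text \<open>The radicand is - s, on the branch cut of the root, where the principal value for s > 0
  has argument pi / 2. This fixes the signs in all later computations on the ray.\<close>

lemma csqrt_i_vertical:
  assumes "0 \<le> s"
  shows "csqrt (\<i> * (\<i> * of_real s)) = \<i> * of_real (sqrt s)"
proof -
  have "\<i> * (\<i> * of_real s) = complex_of_real (- s)"
    by (simp add: complex_eq_iff)
  then show ?thesis
    using assms by (metis csqrt_of_real_nonpos neg_le_0_iff_le abs_minus_cancel abs_of_nonneg Re_complex_of_real Im_complex_of_real)
qed

lemma geodesic_vertical: "geodesic (\<tau> + \<i> * of_real x) (\<tau> + \<i> * of_real t) =
    linepath (\<tau> + \<i> * of_real x) (\<tau> + \<i> * of_real t)"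
  by (simp add: geodesic_def)

text \<open>If \<open>F t = 0\<close>, then \<open>2 F(s) / sqrt s + Q(s)\<close> with
  \<open>Q(s) = \<integral>\<^sub>0\<^sup>s g(x) / sqrt x dx\<close> and \<open>g = - 2 F' - c F\<close> is an antiderivative of
  the integrand; the substitution \<open>x = s y\<^sup>2\<close> removes the singularity of \<open>Q\<close>.\<close>

lemma reg_integral_vertical:
  fixes \<tau> c :: complex and F F' :: "real \<Rightarrow> complex" and f :: "complex \<Rightarrow> complex"
  assumes t: "0 < t"
    and f: "\<And>s. 0 \<le> s \<Longrightarrow> s \<le> t \<Longrightarrow> f (\<tau> + \<i> * of_real s) = F s * (1 + c * of_real s)"
    and F: "\<And>s. 0 \<le> s \<Longrightarrow> (F has_vector_derivative F' s) (at s within {0..})"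
    and F': "continuous_on {0..} F'"
    and Ft: "F t = 0"
  defines "w \<equiv> \<tau> + \<i> * of_real t"
  shows "reg_integrable \<tau> f w"
    and "reg_integral \<tau> f w =
           2 * of_real (sqrt t) * integral {0..1} (\<lambda>v. - 2 * F' (t * v\<^sup>2) - c * F (t * v\<^sup>2))"
proof -
  define g where "g x = - 2 * F' x - c * F x" for x
  have contF: "continuous_on {0..} F"
    by (rule continuous_on_vector_derivative) (use F in auto)
  have contg: "continuous_on {0..} g"
    unfolding g_def by (intro continuous_intros contF F')
  \<comment> \<open>\<open>J (sqrt s)\<close> is the integral Q(s) from the text before the lemma,
    written in the variable y = sqrt x, in which the integrand is continuous at 0.\<close>
  define J where "J y = integral {0..y} (\<lambda>y. 2 * g (y\<^sup>2))" for y
  have contJ': "continuous_on {0..b} (\<lambda>y. 2 * g (y\<^sup>2))" for b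
    by (intro continuous_intros continuous_on_compose2[OF contg]) auto
  have derJ: "(J has_vector_derivative 2 * g (y\<^sup>2)) (at y within {0..b})" if "y \<in> {0..b}" for y b
    unfolding J_def using integral_has_vector_derivative[OF contJ' that] .
  define P where "P s = 2 * F s / of_real (sqrt s) + J (sqrt s)" for s
  \<comment> \<open>At w = \<tau> + i s the denominator is (i sqrt s)^3 = - i s sqrt s and dw = i
    ds, so the integrand in the real variable s carries the factor i / (- i) = - 1.\<close>
  define h where "h s = - (F s * (1 + c * of_real s)) / of_real (s * sqrt s)" for s
  have derP: "(P has_vector_derivative h s) (at s within {a..t})" if "0 < a" "s \<in> {a..t}" for a s
  proof -
    have s: "0 < s" "s \<le> t" using that by auto
    have dF: "(F has_vector_derivative F' s) (at s within {a..t})"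
      using F[of s] s that has_vector_derivative_within_subset by (metis atLeastatMost_subset_iff atLeast_iff Icc_subset_Ici_iff less_imp_le)
    have dr: "((\<lambda>s. inverse (sqrt s)) has_field_derivative - inverse (2 * (s * sqrt s))) (at s within {a..t})"
      using s by (auto intro!: derivative_eq_intros simp: field_simps power2_eq_square)
    have dJ: "((J \<circ> sqrt) has_vector_derivative inverse (2 * sqrt s) *\<^sub>R (2 * g ((sqrt s)\<^sup>2))) (at s within {a..t})"
    proof (rule vector_diff_chain_within)
      show "(sqrt has_vector_derivative inverse (2 * sqrt s)) (at s within {a..t})"
        unfolding has_real_derivative_iff_has_vector_derivative[symmetric]
        using s by (auto intro!: derivative_eq_intros simp: field_simps)
      show "(J has_vector_derivative 2 * g ((sqrt s)\<^sup>2)) (at (sqrt s) within sqrt ` {a..t})"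
        by (rule has_vector_derivative_within_subset[OF derJ[of _ "sqrt t"]]) (use s that in auto)
    qed
    have "((\<lambda>s. 2 * (inverse (sqrt s) *\<^sub>R F s) + (J \<circ> sqrt) s) has_vector_derivative
        2 * (inverse (sqrt s) *\<^sub>R F' s + (- inverse (2 * (s * sqrt s))) *\<^sub>R F s)
         + inverse (2 * sqrt s) *\<^sub>R (2 * g ((sqrt s)\<^sup>2))) (at s within {a..t})"
      by (intro has_vector_derivative_add has_vector_derivative_mult_right
           has_vector_derivative_scaleR dF dJ dr)
    \<comment> \<open>The terms with \<open>F' s\<close> cancel; this is the reason for the summand
      - 2 F' in \<open>g\<close>.\<close>
    moreover have "2 * (inverse (sqrt s) *\<^sub>R F' s + (- inverse (2 * (s * sqrt s))) *\<^sub>R F s)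
         + inverse (2 * sqrt s) *\<^sub>R (2 * g ((sqrt s)\<^sup>2)) = h s"
      using s by (simp add: h_def g_def scaleR_conv_of_real field_simps)
    moreover have "(\<lambda>s. 2 * (inverse (sqrt s) *\<^sub>R F s) + (J \<circ> sqrt) s) = P"
      by (simp add: P_def fun_eq_iff scaleR_conv_of_real field_simps)
    ultimately show ?thesis by simp
  qed
  have ci: "(reg_integrand \<tau> f has_contour_integral P t - P a) (geodesic (\<tau> + \<i> * of_real a) w)"
    if a: "0 < a" "a \<le> t" for a
    unfolding w_def geodesic_vertical has_contour_integral_linepath
  proof -
    define l where "l x = a + (t - a) * x" for x
    have lx: "l x \<in> {a..t}" if "x \<in> {0..1}" for x
      using that a mult_left_le[of x "t - a"] by (auto simp: l_def)
    have "((\<lambda>x. (t - a) *\<^sub>R h (l x)) has_integral ((P \<circ> l) 1 - (P \<circ> l) 0)) {0..1}"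
    proof (rule fundamental_theorem_of_calculus)
      fix x :: real assume x: "x \<in> {0..1}"
      show "((P \<circ> l) has_vector_derivative (t - a) *\<^sub>R h (l x)) (at x within {0..1})"
      proof (rule vector_diff_chain_within)
        show "(l has_vector_derivative t - a) (at x within {0..1})"
          unfolding has_real_derivative_iff_has_vector_derivative[symmetric] l_def
          by (auto intro!: derivative_eq_intros)
        show "(P has_vector_derivative h (l x)) (at (l x) within l ` {0..1})"
          by (rule has_vector_derivative_within_subset[OF derP[of a "l x"]]) (use a lx x in auto)
      qed
    qed simp
    moreover have "(t - a) *\<^sub>R h (l x) = reg_integrand \<tau> f (linepath (\<tau> + \<i> * of_real a) (\<tau> + \<i> * of_real t) x) *
         (\<tau> + \<i> * of_real t - (\<tau> + \<i> * of_real a))" if "x \<in> {0..1}" for x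
    proof -
      have l: "0 < l x" "l x \<le> t" using lx[OF that] a by auto
      have e1: "linepath (\<tau> + \<i> * of_real a) (\<tau> + \<i> * of_real t) x = \<tau> + \<i> * of_real (l x)"
        by (simp add: linepath_def l_def scaleR_conv_of_real algebra_simps)
      have e2: "csqrt (\<i> * (\<i> * of_real (l x))) ^ 3 = - \<i> * of_real (l x * sqrt (l x))"
      proof -
        have "of_real (sqrt (l x)) * of_real (sqrt (l x)) = (of_real (l x) :: complex)"
          using l by (simp flip: of_real_mult)
        moreover have "(\<i> * x) ^ 3 = - \<i> * (x * x * x)" for x
          by (simp add: power3_eq_cube algebra_simps)
        ultimately show ?thesis
          unfolding csqrt_i_vertical[OF less_imp_le[OF l(1)]] by simp
      qed
      show ?thesis
        unfolding e1 reg_integrand_def add_diff_cancel_left' e2 f[OF less_imp_le[OF l(1)] l(2)]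
        using l by (simp add: h_def scaleR_conv_of_real field_simps)
    qed
    ultimately show "((\<lambda>x. reg_integrand \<tau> f (linepath (\<tau> + \<i> * of_real a) (\<tau> + \<i> * of_real t) x) *
         (\<tau> + \<i> * of_real t - (\<tau> + \<i> * of_real a))) has_integral P t - P a) {0..1}"
      using has_integral_eq[of "{0..1}" "\<lambda>x. (t - a) *\<^sub>R h (l x)"] by (simp add: l_def)
  qed
  have seg: "path_image (geodesic \<tau> w) = (\<lambda>a. \<tau> + \<i> * of_real a) ` {0..t}"
  proof -
    have "geodesic \<tau> w = linepath \<tau> w"
      by (simp add: geodesic_def w_def)
    moreover have "closed_segment \<tau> w = (\<lambda>a. \<tau> + \<i> * of_real a) ` {0..t}"
    proof -
      have "(\<lambda>a. \<tau> + \<i> * of_real a) ` closed_segment 0 t = (\<lambda>z. \<tau> + z) ` ((\<lambda>a. \<i> * of_real a) ` closed_segment 0 t)"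
        by (simp add: image_image)
      also have "(\<lambda>a. \<i> * of_real a) ` closed_segment 0 t = closed_segment (\<i> * of_real 0) (\<i> * of_real t)"
        by (intro closed_segment_linear_image[symmetric]) (auto intro!: linearI simp: algebra_simps scaleR_conv_of_real)
      finally show ?thesis
        using t by (simp add: closed_segment_eq_real_ivl w_def closed_segment_translation[symmetric])
    qed
    ultimately show ?thesis by simp
  qed
  \<comment> \<open>The counterterm 2 i F(0) / (i sqrt a) equals 2 F(0) / sqrt a. Combined with -
    \<open>P a\<close> it leaves - 2 (F(a) - F(0)) / sqrt a - J(sqrt a), which has no singularity at
    a = 0.\<close>
  define R where "R a = P t - P a + 2 * F 0 / of_real (sqrt a)" for a
  have approx: "reg_approx \<tau> f w (\<tau> + \<i> * of_real a) = R a" if a: "0 < a" "a \<le> t" for a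
  proof -
    have 1: "contour_integral (geodesic (\<tau> + \<i> * of_real a) w) (reg_integrand \<tau> f) = P t - P a"
      using ci[OF a] contour_integral_unique by blast
    have 2: "f \<tau> = F 0" using f[of 0] t by simp
    show ?thesis
      unfolding reg_approx_def R_def 1 2 using a by (simp add: csqrt_i_vertical)
  qed
  have lim: "(reg_approx \<tau> f w \<longlongrightarrow> J (sqrt t)) (at \<tau> within path_image (geodesic \<tau> w))"
  proof -
    have "(R \<longlongrightarrow> J (sqrt t)) (at_right 0)"
    proof -
      \<comment> \<open>Differentiability at 0 gives F(a) - F(0) = O(a), so its quotient by sqrt a
        tends to 0. The quotient is written as sqrt a times the error of the linear approximation
        divided by a, plus sqrt a times \<open>F' 0\<close>.\<close>
      have "((\<lambda>a. (1 / norm (a - 0)) *\<^sub>R (F a - (F 0 + (a - 0) *\<^sub>R F' 0))) \<longlongrightarrow> 0) (at 0 within {0..})"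
        using F[of 0] unfolding has_vector_derivative_def has_derivative_within by blast
      then have "((\<lambda>a. (1 / norm (a - 0)) *\<^sub>R (F a - (F 0 + (a - 0) *\<^sub>R F' 0))) \<longlongrightarrow> 0) (at_right 0)"
        by (rule tendsto_within_subset) auto
      moreover have sq: "((\<lambda>a. sqrt a) \<longlongrightarrow> 0) (at_right 0)"
        by (auto intro!: tendsto_eq_intros)
      ultimately have "((\<lambda>a. sqrt a *\<^sub>R ((1 / norm (a - 0)) *\<^sub>R (F a - (F 0 + (a - 0) *\<^sub>R F' 0))) + sqrt a *\<^sub>R F' 0)
          \<longlongrightarrow> 0 *\<^sub>R 0 + 0 *\<^sub>R F' 0) (at_right 0)"
        by (intro tendsto_intros)
      then have "((\<lambda>a. (F a - F 0) / of_real (sqrt a)) \<longlongrightarrow> 0 *\<^sub>R 0 + 0 *\<^sub>R F' 0) (at_right 0)"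
      proof (rule Lim_transform_eventually[OF _ eventually_at_rightI[of 0 1]])
        fix a :: real assume "a \<in> {0<..<1}"
        then have a: "0 < sqrt a" "a = sqrt a * sqrt a" by auto
        define b where "b = sqrt a"
        show "sqrt a *\<^sub>R ((1 / norm (a - 0)) *\<^sub>R (F a - (F 0 + (a - 0) *\<^sub>R F' 0))) + sqrt a *\<^sub>R F' 0 =
            (F a - F 0) / of_real (sqrt a)"
          using a unfolding b_def[symmetric] real_norm_def
          by (simp add: scaleR_conv_of_real field_simps)
      qed auto
      then have quot: "((\<lambda>a. (F a - F 0) / of_real (sqrt a)) \<longlongrightarrow> 0) (at_right 0)"
        by simp
      have "continuous_on {0..1} J"
        by (rule continuous_on_vector_derivative) (use derJ in blast)
      then have "(J \<longlongrightarrow> J 0) (at 0 within {0..1})"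
        by (simp add: continuous_on)
      moreover have "filterlim sqrt (at 0 within {0..1}) (at_right 0)"
        unfolding filterlim_at using sq by (auto intro!: eventually_at_rightI[of 0 1])
      ultimately have "((\<lambda>a. J (sqrt a)) \<longlongrightarrow> J 0) (at_right 0)"
        by (rule filterlim_compose)
      then have "((\<lambda>a. P t - J (sqrt a) - 2 * ((F a - F 0) / of_real (sqrt a))) \<longlongrightarrow> P t - J 0 - 2 * 0) (at_right 0)"
        by (intro tendsto_intros quot)
      \<comment> \<open>The boundary term 2 F(t) / sqrt t in \<open>P t\<close> is zero by
        \<open>Ft\<close>; only the convergent integral remains.\<close>
      moreover have "P t - J 0 - 2 * 0 = J (sqrt t)"
        by (simp add: P_def Ft J_def)
      moreover have "(\<lambda>a. P t - J (sqrt a) - 2 * ((F a - F 0) / of_real (sqrt a))) = R"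
        by (simp add: fun_eq_iff R_def P_def diff_divide_distrib algebra_simps)
      ultimately show ?thesis by simp
    qed
    \<comment> \<open>A point z of the segment has the parameter a = Im (z - \<tau>), which
      transports the limit a -> 0 from the right to the limit z -> \<tau> along the
      geodesic.\<close>
    moreover have "filterlim (\<lambda>z. Im (z - \<tau>)) (at_right 0) (at \<tau> within path_image (geodesic \<tau> w))"
      unfolding filterlim_at
    proof
      show "((\<lambda>z. Im (z - \<tau>)) \<longlongrightarrow> 0) (at \<tau> within path_image (geodesic \<tau> w))"
        by (auto intro!: tendsto_eq_intros)
      show "\<forall>\<^sub>F z in at \<tau> within path_image (geodesic \<tau> w). Im (z - \<tau>) \<in> {0<..} \<and> Im (z - \<tau>) \<noteq> 0"
        unfolding eventually_at_filter by (rule always_eventually) (auto simp: seg)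
    qed
    ultimately have "((\<lambda>z. R (Im (z - \<tau>))) \<longlongrightarrow> J (sqrt t)) (at \<tau> within path_image (geodesic \<tau> w))"
      by (rule filterlim_compose)
    moreover have "\<forall>\<^sub>F z in at \<tau> within path_image (geodesic \<tau> w). R (Im (z - \<tau>)) = reg_approx \<tau> f w z"
      unfolding eventually_at_filter
      by (rule always_eventually) (auto simp: seg approx)
    ultimately show ?thesis
      by (rule Lim_transform_eventually)
  qed
  \<comment> \<open>\<open>Lim\<close> is determined by convergence only if the filter is
    nontrivial; \<tau> is a limit point of the segment because a connected set with more than one
    point is perfect.\<close>
  have nb: "at \<tau> within path_image (geodesic \<tau> w) \<noteq> bot"
  proof -
    have "\<tau> \<noteq> w" using t by (simp add: w_def)
    moreover from this have "closed_segment \<tau> w \<noteq> {x}" for x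
      by (metis ends_in_segment singletonD)
    ultimately have "\<tau> islimpt closed_segment \<tau> w"
      by (intro connected_imp_perfect) auto
    moreover have "path_image (geodesic \<tau> w) = closed_segment \<tau> w"
      by (simp add: geodesic_def w_def)
    ultimately show ?thesis by (simp add: trivial_limit_within)
  qed
  show "reg_integrable \<tau> f w"
    unfolding reg_integrable_def
  proof (intro conjI ballI)
    fix z assume "z \<in> path_image (geodesic \<tau> w) - {\<tau>}"
    then obtain a where "z = \<tau> + \<i> * of_real a" "0 < a" "a \<le> t"
      by (auto simp: seg less_le)
    then show "reg_integrand \<tau> f contour_integrable_on geodesic z w"
      using ci contour_integrable_on_def by blast
  qed (use lim in blast)
  have "reg_integral \<tau> f w = J (sqrt t)"
    unfolding reg_integral_def using tendsto_Lim[OF nb lim] .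
  \<comment> \<open>The rescaling y = sqrt t * v makes the range independent of t; the factor sqrt t
    later cancels against the root in the outer integral.\<close>
  also have "J (sqrt t) = 2 * of_real (sqrt t) * integral {0..1} (\<lambda>v. g (t * v\<^sup>2))"
  proof -
    have "integral {0..sqrt t} (\<lambda>y. 2 * g (y\<^sup>2)) = sqrt t *\<^sub>R integral {0..1} (\<lambda>v. 2 * g ((sqrt t * v)\<^sup>2))"
    proof -
      have "((\<lambda>y. 2 * g (y\<^sup>2)) has_integral J (sqrt t)) (cbox 0 (sqrt t))"
        unfolding J_def cbox_interval by (intro integrable_integral integrable_continuous_real contJ')
      from has_integral_affinity[OF this, of "sqrt t" 0]
      have "((\<lambda>v. 2 * g ((sqrt t * v)\<^sup>2)) has_integral (1 / sqrt t) *\<^sub>R J (sqrt t)) ((\<lambda>x. inverse (sqrt t) * x) ` {0..sqrt t})"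
        using t by (simp add: divide_inverse)
      moreover have "(\<lambda>x. inverse (sqrt t) * x) ` {0..sqrt t} = {0..1}"
        using t by (subst image_mult_atLeastAtMost) auto
      ultimately have "integral {0..1} (\<lambda>v. 2 * g ((sqrt t * v)\<^sup>2)) = (1 / sqrt t) *\<^sub>R J (sqrt t)"
        by (simp only: integral_unique)
      then show ?thesis
        using t by (simp only: J_def) simp
    qed
    then show ?thesis
      using t by (simp add: J_def power_mult_distrib scaleR_conv_of_real)
  qed
  finally show "reg_integral \<tau> f w =
           2 * of_real (sqrt t) * integral {0..1} (\<lambda>v. - 2 * F' (t * v\<^sup>2) - c * F (t * v\<^sup>2))"
    by (simp add: g_def)
qed

section \<open>Termwise integration\<close>

lemma integral_exp_minus:
  fixes a :: real assumes "0 < a"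
  shows "set_integrable lborel {0<..} (\<lambda>t. exp (- a * t))" "(LBINT t:{0<..}. exp (- a * t)) = 1 / a"
proof -
  have "(\<integral>\<^sup>+t. ennreal (exp (- a * t)) * indicator {0..} t \<partial>lborel) = ennreal (0 - (- exp (- a * 0) / a))"
  proof (rule nn_integral_FTC_atLeast)
    show "((\<lambda>t. - exp (- a * t) / a) \<longlongrightarrow> 0) at_top"
      using assms by real_asymp
  qed (use assms in \<open>auto intro!: derivative_eq_intros\<close>)
  then have nn: "(\<integral>\<^sup>+t. ennreal (indicator {0<..} t * exp (- a * t)) \<partial>lborel) = ennreal (1 / a)"
  proof -
    have "(\<integral>\<^sup>+t. ennreal (indicator {0<..} t * exp (- a * t)) \<partial>lborel) =
      (\<integral>\<^sup>+t. ennreal (exp (- a * t)) * indicator {0..} t \<partial>lborel)"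
      by (rule nn_integral_cong_AE, rule AE_I[of _ _ "{0}"]) (auto split: split_indicator simp: less_le)
    then show ?thesis using \<open>_ = ennreal (0 - _)\<close> by simp
  qed
  have nonneg: "0 \<le> indicator {0<..} t * exp (- a * t)" for t by simp
  have "integrable lborel (\<lambda>t. indicator {0<..} t * exp (- a * t))"
    using nn by (intro integrableI_nonneg) auto
  then show "set_integrable lborel {0<..} (\<lambda>t. exp (- a * t))"
    by (simp add: set_integrable_def)
  show "(LBINT t:{0<..}. exp (- a * t)) = 1 / a"
    unfolding set_lebesgue_integral_def real_scaleR_def
    by (rule integral_eq_nn_integral[THEN trans]) (use assms nn in auto)
qed

lemma integral_inverse_quadratic:
  fixes a b :: real assumes "0 < a" "0 < b"
  shows "set_integrable lborel {0..1} (\<lambda>v. 1 / (a + b * v\<^sup>2))"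
    "(LBINT v:{0..1}. 1 / (a + b * v\<^sup>2)) = arctan (sqrt (b / a)) / sqrt (a * b)"
proof -
  have pos: "0 < a + b * v\<^sup>2" for v
    using assms by (simp add: add_pos_nonneg)
  have cont: "continuous_on {0..1} (\<lambda>v. 1 / (a + b * v\<^sup>2))"
    using pos by (auto intro!: continuous_intros simp: less_imp_neq[symmetric])
  show si: "set_integrable lborel {0..1} (\<lambda>v. 1 / (a + b * v\<^sup>2))"
    unfolding set_integrable_def by (rule borel_integrable_compact) (auto intro: cont)
  have "((\<lambda>v. 1 / (a + b * v\<^sup>2)) has_integral
      arctan (sqrt (b / a) * 1) / sqrt (a * b) - arctan (sqrt (b / a) * 0) / sqrt (a * b)) {0..1}"
  proof (rule fundamental_theorem_of_calculus)
    fix v :: real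
    have "((\<lambda>v. arctan (sqrt (b / a) * v) / sqrt (a * b)) has_field_derivative
        (inverse (1 + (sqrt (b / a) * v)\<^sup>2) * sqrt (b / a)) / sqrt (a * b)) (at v within {0..1})"
      by (intro DERIV_cdivide) (auto intro!: derivative_eq_intros)
    moreover have "(inverse (1 + (sqrt (b / a) * v)\<^sup>2) * sqrt (b / a)) / sqrt (a * b) = 1 / (a + b * v\<^sup>2)"
    proof -
      have 1: "sqrt (b / a) / sqrt (a * b) = 1 / a"
        using assms by (simp add: real_sqrt_divide real_sqrt_mult field_simps)
      have 2: "1 + (sqrt (b / a) * v)\<^sup>2 = (a + b * v\<^sup>2) / a"
        using assms by (simp add: power_mult_distrib field_simps)
      show ?thesis
        unfolding 2 times_divide_eq_right[symmetric] 1 using assms by simp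
    qed
    ultimately show "((\<lambda>v. arctan (sqrt (b / a) * v) / sqrt (a * b)) has_vector_derivative
        1 / (a + b * v\<^sup>2)) (at v within {0..1})"
      by (simp add: has_real_derivative_iff_has_vector_derivative)
  qed simp
  then have "integral {0..1} (\<lambda>v. 1 / (a + b * v\<^sup>2)) = arctan (sqrt (b / a)) / sqrt (a * b)"
    by (simp add: integral_unique)
  then show "(LBINT v:{0..1}. 1 / (a + b * v\<^sup>2)) = arctan (sqrt (b / a)) / sqrt (a * b)"
    using set_borel_integral_eq_integral(2)[OF si] by simp
qed

text \<open>By Fubini the integration over t may come first; it gives 1 / (a + b v^2), whose
  integral over v is an arctangent. With s = t v^2 this is half of the double integral with kernel 1
  / sqrt (s t).\<close>

lemma laplace_inverse_quadratic:
  fixes a b :: real assumes "0 < a" "0 < b"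
  defines "k \<equiv> \<lambda>t. LBINT v:{0..1}. exp (- (a + b * v\<^sup>2) * t)"
  shows "set_integrable lborel {0<..} k"
    "(LBINT t:{0<..}. k t) = arctan (sqrt (b / a)) / sqrt (a * b)"
proof -
  define f where "f t v = indicator {0<..} t * (indicator {0..1} v * exp (- (a + b * v\<^sup>2) * t))" for t v :: real
  have pos: "0 < a + b * v\<^sup>2" for v
    using assms by (simp add: add_pos_nonneg)
  have inner: "(LBINT t. f t v) = indicator {0..1} v * (1 / (a + b * v\<^sup>2))"
     "integrable lborel (\<lambda>t. f t v)" for v
  proof -
    have "f t v = indicator {0..1} v * (indicator {0<..} t *\<^sub>R exp (- (a + b * v\<^sup>2) * t))" for t
      by (simp add: f_def)
    then show "(LBINT t. f t v) = indicator {0..1} v * (1 / (a + b * v\<^sup>2))" "integrable lborel (\<lambda>t. f t v)"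
      using integral_exp_minus[OF pos[of v]] unfolding set_integrable_def set_lebesgue_integral_def
      by (simp_all only: integral_mult_right_zero integrable_mult_right)
  qed
  have fm [measurable]: "(\<lambda>(v, t). f t v) \<in> borel_measurable (lborel \<Otimes>\<^sub>M lborel)"
    unfolding f_def by measurable
  have int: "integrable (lborel \<Otimes>\<^sub>M lborel) (\<lambda>(v, t). f t v)"
  proof (rule lborel_pair.Fubini_integrable[OF fm])
    have "norm (f t v) = f t v" for t v by (simp add: f_def)
    then show "integrable lborel (\<lambda>v. LBINT t. norm (case (v, t) of (v, t) \<Rightarrow> f t v))"
      using integral_inverse_quadratic(1)[OF assms(1,2)] by (simp add: inner set_integrable_def)
  qed (simp add: inner)
  have fk: "(LBINT v. f t v) = indicator {0<..} t *\<^sub>R k t" for t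
    by (simp add: f_def k_def set_lebesgue_integral_def)
  show "set_integrable lborel {0<..} k"
    using lborel_pair.integrable_snd[OF int] by (simp add: set_integrable_def fk)
  have "(LBINT t:{0<..}. k t) = (LBINT t. LBINT v. f t v)"
    by (simp add: fk set_lebesgue_integral_def)
  also have "\<dots> = (LBINT v. LBINT t. f t v)"
    using lborel_pair.Fubini_integral[OF int] .
  also have "\<dots> = arctan (sqrt (b / a)) / sqrt (a * b)"
    using integral_inverse_quadratic(2)[OF assms(1,2)] by (simp add: inner set_lebesgue_integral_def)
  finally show "(LBINT t:{0<..}. k t) = arctan (sqrt (b / a)) / sqrt (a * b)" .
qed

section \<open>Products of two exponential series, integrated term by term\<close>

lemma infinite_int_prod: "infinite (UNIV :: (int \<times> int) set)"
  by (simp add: finite_prod infinite_UNIV_int)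

lemma infsum_mult_infsum:
  fixes c :: "'a \<Rightarrow> complex" and d :: "'b \<Rightarrow> complex"
  assumes c: "(\<lambda>j. norm (c j)) summable_on UNIV" and d: "(\<lambda>k. norm (d k)) summable_on UNIV"
  shows "(\<lambda>(j, k). norm (c j * d k)) summable_on UNIV"
    and "(\<Sum>\<^sub>\<infinity>(j, k). c j * d k) = (\<Sum>\<^sub>\<infinity>j. c j) * (\<Sum>\<^sub>\<infinity>k. d k)"
proof -
  have "(\<lambda>p. norm (case p of (j, k) \<Rightarrow> c j * d k)) summable_on UNIV \<times> UNIV"
    by (rule Infinite_Sum.abs_summable_on_Sigma_iff[THEN iffD2])
      (use assms in \<open>auto simp: norm_mult infsum_cmult_right' abs_mult infsum_nonneg intro!: summable_on_cmult_right summable_on_cmult_left\<close>)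
  then have s: "(\<lambda>p. norm (case p of (j, k) \<Rightarrow> c j * d k)) summable_on UNIV" by simp
  then show "(\<lambda>(j, k). norm (c j * d k)) summable_on UNIV"
    by (simp add: case_prod_unfold)
  have "(\<Sum>\<^sub>\<infinity>(j, k)\<in>UNIV \<times> UNIV. c j * d k) = (\<Sum>\<^sub>\<infinity>j. \<Sum>\<^sub>\<infinity>k. c j * d k)"
    using abs_summable_summable[OF s] by (intro infsum_Sigma'_banach[symmetric]) simp
  then show "(\<Sum>\<^sub>\<infinity>(j, k). c j * d k) = (\<Sum>\<^sub>\<infinity>j. c j) * (\<Sum>\<^sub>\<infinity>k. d k)"
    by (simp add: infsum_cmult_right' infsum_cmult_left')
qed

text \<open>Two interchanges of sum and integral, first over v at fixed t, then over t, reduce the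
  claim to \<open>laplace_inverse_quadratic\<close> for each pair (j, k). Both majorants are
  multiples of \<open>norm (c j * d k)\<close>.\<close>

lemma integral_exp_series_product:
  fixes c d :: "int \<Rightarrow> complex" and \<gamma> \<delta> :: "int \<Rightarrow> real"
  assumes \<epsilon>: "0 < \<epsilon>" "\<And>j. \<epsilon> \<le> \<gamma> j" "\<And>k. \<epsilon> \<le> \<delta> k"
    and c: "(\<lambda>j. norm (c j)) summable_on UNIV" and d: "(\<lambda>k. norm (d k)) summable_on UNIV"
  defines "A \<equiv> \<lambda>t. \<Sum>\<^sub>\<infinity>j. c j * of_real (exp (- \<gamma> j * t))"
    and "B \<equiv> \<lambda>s. \<Sum>\<^sub>\<infinity>k. d k * of_real (exp (- \<delta> k * s))"
  defines "h \<equiv> \<lambda>t. A t * integral {0..1} (\<lambda>v. B (t * v\<^sup>2))"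
    and "W \<equiv> \<lambda>(j, k). c j * d k * of_real (arctan (sqrt (\<delta> k / \<gamma> j)) / sqrt (\<gamma> j * \<delta> k))"
  shows "set_integrable lborel {0<..} h"
    and "(LBINT t:{0<..}. h t) = (\<Sum>\<^sub>\<infinity>p. W p)"
    and "(\<lambda>p. norm (W p)) summable_on UNIV"
proof -
  have pos: "0 < \<gamma> j" "0 < \<delta> k" for j k
    using \<epsilon> less_le_trans by blast+
  have nexp: "norm (z * complex_of_real (exp (- (a * x)))) \<le> norm z" if "0 < a" "0 \<le> x" for z a x
    using that unfolding norm_mult by (intro mult_left_le) auto
  define C where "C = (\<lambda>(j, k). c j * d k)"
  have C: "(\<lambda>p. norm (C p)) summable_on UNIV"
    using infsum_mult_infsum(1)[OF c d] by (simp add: C_def case_prod_unfold)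
  define E where "E = (\<lambda>(j, k) t v. exp (- (\<gamma> j + \<delta> k * v\<^sup>2) * t))"
  have E: "0 < E p t v" "0 \<le> t \<Longrightarrow> E p t v \<le> 1" for p t v
  proof -
    have *: "exp (- a * t) \<le> 1" if "0 \<le> a" "0 \<le> t" for a
      using that by simp
    show "0 \<le> t \<Longrightarrow> E p t v \<le> 1"
      unfolding E_def case_prod_unfold using pos(1)[of "fst p"] pos(2)[of "snd p"] by (intro *) auto
  qed (simp add: E_def case_prod_unfold)
  have contE: "continuous_on S (\<lambda>v. E p t v)" for p t S
    unfolding E_def case_prod_unfold by (intro continuous_intros)
  define k where "k p t = (LBINT v:{0..1}. E p t v)" for p t
  have intE: "set_integrable lborel {0..1} (E p t)" for p t
    unfolding set_integrable_def by (rule borel_integrable_compact) (auto intro: contE)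
  have k: "0 \<le> k p t" "0 \<le> t \<Longrightarrow> k p t \<le> 1" for p t
  proof -
    show "0 \<le> k p t"
      unfolding k_def set_lebesgue_integral_def by (rule integral_nonneg_AE) (use E in \<open>auto simp: less_imp_le\<close>)
    assume "0 \<le> t"
    then have "k p t \<le> (LBINT v:{0..1::real}. 1)"
      unfolding k_def by (intro set_integral_mono intE) (use E in \<open>auto simp: set_integrable_def\<close>)
    then show "k p t \<le> 1" by (simp add: set_lebesgue_integral_def)
  qed
  define K where "K = (\<lambda>(j, k). arctan (sqrt (\<delta> k / \<gamma> j)) / sqrt (\<gamma> j * \<delta> k))"
  have K: "set_integrable lborel {0<..} (k p)" "(LBINT t:{0<..}. k p t) = K p" for p
    using laplace_inverse_quadratic[OF pos(1)[of "fst p"] pos(2)[of "snd p"]]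
    by (simp_all add: k_def[abs_def] E_def K_def case_prod_unfold)
  \<comment> \<open>Here the common lower bound \<epsilon> of the rates enters: it bounds the
    integrals over t uniformly in p, so summability of \<open>C\<close> is enough for the second
    interchange.\<close>
  have Kb: "\<bar>K p\<bar> \<le> (pi / 2) / \<epsilon>" for p
  proof -
    obtain j k where p: "p = (j, k)" by force
    have "\<epsilon> = sqrt (\<epsilon> * \<epsilon>)" using \<epsilon> by simp
    also have "\<dots> \<le> sqrt (\<gamma> j * \<delta> k)"
      using \<epsilon>(2)[of j] \<epsilon>(3)[of k] \<epsilon>(1) by (intro real_sqrt_le_mono mult_mono) auto
    finally have "\<epsilon> \<le> sqrt (\<gamma> j * \<delta> k)" .
    moreover have "\<bar>arctan (sqrt (\<delta> k / \<gamma> j))\<bar> \<le> pi / 2"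
      using arctan_lbound[of "sqrt (\<delta> k / \<gamma> j)"] arctan_ubound[of "sqrt (\<delta> k / \<gamma> j)"] by linarith
    ultimately have "\<bar>arctan (sqrt (\<delta> k / \<gamma> j))\<bar> / sqrt (\<gamma> j * \<delta> k) \<le> (pi / 2) / \<epsilon>"
      using \<epsilon>(1) by (intro frac_le) auto
    moreover have "\<bar>sqrt (\<gamma> j * \<delta> k)\<bar> = sqrt (\<gamma> j * \<delta> k)"
      using pos(1)[of j] pos(2)[of k] by simp
    ultimately show ?thesis
      unfolding p K_def prod.case abs_divide by simp
  qed
  have W: "W p = C p * of_real (K p)" for p
    by (simp add: W_def C_def K_def case_prod_unfold)
  show "(\<lambda>p. norm (W p)) summable_on UNIV"
  proof (rule summable_on_comparison_test)
    show "(\<lambda>p. norm (C p) * ((pi / 2) / \<epsilon>)) summable_on UNIV"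
      by (intro summable_on_cmult_left C)
    show "norm (W p) \<le> norm (C p) * ((pi / 2) / \<epsilon>)" for p
      unfolding W norm_mult norm_of_real by (intro mult_left_mono Kb) auto
  qed auto
  \<comment> \<open>First interchange: for t > 0 each \<open>E p t v\<close> is at most 1, so
    \<open>norm (C p)\<close> is a majorant.\<close>
  have h: "h t = (\<Sum>\<^sub>\<infinity>p. C p * of_real (k p t))" if t: "0 < t" for t
  proof -
    define f where "f p v = indicator {0..1} v *\<^sub>R (C p * of_real (E p t v))" for p v
    have nf: "norm (f p v) = norm (C p) * (indicator {0..1} v *\<^sub>R E p t v)" for p v
      using E(1)[of p t v] by (simp add: f_def norm_mult split: split_indicator)
    have nf1: "norm (f p v) \<le> norm (C p)" for p v
      unfolding nf using E(1)[of p t v] E(2)[of t p v] t by (intro mult_left_le) (auto split: split_indicator)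
    have intf: "integrable lborel (f p)" for p
    proof -
      have "integrable lborel (\<lambda>v. C p * of_real (indicator {0..1} v *\<^sub>R E p t v))"
        using intE[of p t] unfolding set_integrable_def by (intro integrable_mult_right integrable_of_real)
      then show ?thesis by (simp add: f_def[abs_def] scaleR_conv_of_real mult_ac)
    qed
    have n: "(\<lambda>p. LBINT v. norm (f p v)) summable_on UNIV"
    proof (rule summable_on_comparison_test[OF C])
      fix p
      have "(LBINT v. norm (f p v)) = norm (C p) * k p t"
        by (simp add: nf k_def set_lebesgue_integral_def)
      then show "(LBINT v. norm (f p v)) \<le> norm (C p)"
        using k(1)[of p t] k(2)[of t p] t by (simp add: mult_left_le)
    qed auto
    have sf: "(\<lambda>p. norm (f p v)) summable_on UNIV" for v
      by (rule summable_on_comparison_test[OF C]) (auto intro: nf1)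
    have AB: "A t * B (t * v\<^sup>2) = (\<Sum>\<^sub>\<infinity>p. C p * of_real (E p t v))" for v
    proof -
      have "(\<lambda>j. norm (c j * of_real (exp (- \<gamma> j * t)))) summable_on UNIV"
        by (rule summable_on_comparison_test[OF c])
           (use t pos in \<open>auto intro!: nexp\<close>)
      moreover have "(\<lambda>k. norm (d k * of_real (exp (- \<delta> k * (t * v\<^sup>2))))) summable_on UNIV"
        by (rule summable_on_comparison_test[OF d])
           (use t pos in \<open>auto intro!: nexp\<close>)
      ultimately have "A t * B (t * v\<^sup>2) =
        (\<Sum>\<^sub>\<infinity>(j, k). (c j * of_real (exp (- \<gamma> j * t))) * (d k * of_real (exp (- \<delta> k * (t * v\<^sup>2)))))"
        unfolding A_def B_def by (rule infsum_mult_infsum(2)[symmetric])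
      also have "\<dots> = (\<Sum>\<^sub>\<infinity>p. C p * of_real (E p t v))"
        by (intro infsum_cong) (auto simp: C_def E_def algebra_simps simp flip: exp_add of_real_mult)
      finally show ?thesis .
    qed
    have contB: "continuous_on {0..1} (\<lambda>v. B (t * v\<^sup>2))"
      unfolding B_def
    proof (rule continuous_on_infsum[OF _ _ d])
      show "continuous_on {0..1} (\<lambda>v. d k * complex_of_real (exp (- \<delta> k * (t * v\<^sup>2))))" for k
        by (intro continuous_intros)
    qed (use t pos in \<open>auto intro!: nexp\<close>)
    have "set_integrable lborel {0..1} (\<lambda>v. B (t * v\<^sup>2))"
      unfolding set_integrable_def by (rule borel_integrable_compact) (auto intro: contB)
    then have "h t = A t * (LBINT v:{0..1}. B (t * v\<^sup>2))"
      by (simp add: h_def set_borel_integral_eq_integral)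
    also have "\<dots> = (LBINT v. indicator {0..1} v *\<^sub>R (A t * B (t * v\<^sup>2)))"
      unfolding set_lebesgue_integral_def by (simp flip: integral_mult_right_zero)
    also have "\<dots> = (LBINT v. \<Sum>\<^sub>\<infinity>p. f p v)"
      unfolding AB f_def by (intro Bochner_Integration.integral_cong refl) (auto split: split_indicator)
    also have "\<dots> = (\<Sum>\<^sub>\<infinity>p. LBINT v. f p v)"
      by (rule integral_infsum(2)[OF infinite_int_prod intf sf n])
    also have "\<dots> = (\<Sum>\<^sub>\<infinity>p. C p * of_real (k p t))"
    proof (rule infsum_cong)
      fix p
      have "(LBINT v. f p v) = (LBINT v. C p * of_real (indicator {0..1} v *\<^sub>R E p t v))"
        by (simp add: f_def[abs_def] scaleR_conv_of_real mult_ac)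
      then show "(LBINT v. f p v) = C p * of_real (k p t)"
        by (simp add: k_def set_lebesgue_integral_def del: scaleR_conv_of_real real_scaleR_def of_real_mult)
    qed
    finally show ?thesis .
  qed
  \<comment> \<open>Second interchange: extension by zero makes the summands integrable on the whole
    line and absolutely summable at every t, including t \<le> 0.\<close>
  define g where "g p t = indicator {0<..} t *\<^sub>R (C p * of_real (k p t))" for p and t :: real
  have g: "g p t = C p * of_real (indicator {0<..} t *\<^sub>R k p t)" for p t
    by (simp add: g_def split: split_indicator)
  have ng: "norm (g p t) = norm (C p) * (indicator {0<..} t *\<^sub>R k p t)" for p t
    using k(1)[of p t] by (simp add: g_def norm_mult split: split_indicator)
  have 1: "integrable lborel (g p)" for p
    unfolding g[abs_def] using K(1)[of p] unfolding set_integrable_def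
    by (intro integrable_mult_right integrable_of_real)
  have 2: "(\<lambda>p. norm (g p t)) summable_on UNIV" for t
    by (rule summable_on_comparison_test[OF C])
       (use k(1)[of _ t] k(2)[of t] in \<open>auto simp: ng mult_left_le split: split_indicator\<close>)
  have 3: "(\<lambda>p. LBINT t. norm (g p t)) summable_on UNIV"
  proof (rule summable_on_comparison_test)
    show "(\<lambda>p. norm (C p) * ((pi / 2) / \<epsilon>)) summable_on UNIV"
      by (intro summable_on_cmult_left C)
    show "(LBINT t. norm (g p t)) \<le> norm (C p) * ((pi / 2) / \<epsilon>)" for p
    proof -
      have "(LBINT t. norm (g p t)) = norm (C p) * K p"
        using K(2)[of p] by (simp add: ng set_lebesgue_integral_def)
      then show ?thesis
        using mult_left_mono[OF order_trans[OF abs_ge_self Kb[of p]] norm_ge_zero[of "C p"]] by simp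
    qed
  qed auto
  have hg: "indicator {0<..} t *\<^sub>R h t = (\<Sum>\<^sub>\<infinity>p. g p t)" for t
    using h[of t] by (auto simp: g_def split: split_indicator)
  show "set_integrable lborel {0<..} h"
    unfolding set_integrable_def hg by (rule integral_infsum(1)[OF infinite_int_prod 1 2 3])
  have "(LBINT t:{0<..}. h t) = (\<Sum>\<^sub>\<infinity>p. LBINT t. g p t)"
    unfolding set_lebesgue_integral_def hg by (rule integral_infsum(2)[OF infinite_int_prod 1 2 3])
  also have "\<dots> = (\<Sum>\<^sub>\<infinity>p. W p)"
  proof (rule infsum_cong)
    fix p
    show "(LBINT t. g p t) = W p"
      unfolding g[abs_def] integral_mult_right_zero integral_complex_of_real W
      using K(2)[of p] by (simp only: set_lebesgue_integral_def)
  qed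
  finally show "(LBINT t:{0<..}. h t) = (\<Sum>\<^sub>\<infinity>p. W p)" .
qed

section \<open>Cancellation of angles\<close>

lemma arctan_inverse_pos: "0 < x \<Longrightarrow> arctan (1 / x) = pi / 2 - arctan x"
  using arctan_inverse[of x] by (simp add: inverse_eq_divide)

text \<open>(u + v) / (u - v) is tan (pi / 4 + \<theta>) for v < u, by the addition formula with tan
  (pi / 4) = 1. For v > u the same holds with u and v exchanged. Replacing u by - u inverts the
  absolute ratio, hence passes to the complementary angle.\<close>

lemma arctan_ratio:
  fixes u v :: real
  assumes "0 < u" "0 < v" "u \<noteq> v"
  defines "\<theta> \<equiv> arctan (v / u)"
  shows "arctan \<bar>u / v\<bar> = pi / 2 - \<theta>" "arctan \<bar>v / u\<bar> = \<theta>"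
    "arctan \<bar>(u + v) / (u - v)\<bar> = (if v < u then pi / 4 + \<theta> else 3 * pi / 4 - \<theta>)"
    "arctan \<bar>(- u + v) / (- u - v)\<bar> = (if v < u then pi / 4 - \<theta> else \<theta> - pi / 4)"
proof -
  show uv: "arctan \<bar>u / v\<bar> = pi / 2 - \<theta>"
    using arctan_inverse_pos[of "v / u"] assms by simp
  show "arctan \<bar>v / u\<bar> = \<theta>"
    using assms by simp
  have pos: "arctan ((x + y) / (x - y)) = pi / 4 + arctan (y / x)"
    if "0 < y" "y < x" for x y :: real
  proof -
    have "(1 + y / x) / (1 - 1 * (y / x)) = (x + y) / (x - y)"
      using that by (simp add: divide_simps)
    then show ?thesis
      using that arctan_add[of 1 "y / x"] by (simp add: arctan_one)
  qed
  have A: "arctan \<bar>(u + v) / (u - v)\<bar> = (if v < u then pi / 4 + \<theta> else 3 * pi / 4 - \<theta>)"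
  proof (cases "v < u")
    case True
    then show ?thesis using pos[of v u] assms by (simp add: \<theta>_def)
  next
    case False
    then have "arctan \<bar>(u + v) / (u - v)\<bar> = arctan ((v + u) / (v - u))"
      using assms by (simp add: abs_divide add.commute)
    then show ?thesis using pos[of u v] False assms uv by simp
  qed
  then show "arctan \<bar>(u + v) / (u - v)\<bar> = (if v < u then pi / 4 + \<theta> else 3 * pi / 4 - \<theta>)" .
  have "\<bar>(- u + v) / (- u - v)\<bar> = 1 / \<bar>(u + v) / (u - v)\<bar>"
    by (simp add: abs_divide abs_minus_commute) (metis abs_minus_cancel minus_add_distrib add.commute uminus_add_conv_diff)
  moreover have "0 < \<bar>(u + v) / (u - v)\<bar>" using assms by simp
  ultimately have "arctan \<bar>(- u + v) / (- u - v)\<bar> = pi / 2 - arctan \<bar>(u + v) / (u - v)\<bar>"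
    using arctan_inverse_pos[of "\<bar>(u + v) / (u - v)\<bar>"] by simp
  then show "arctan \<bar>(- u + v) / (- u - v)\<bar> = (if v < u then pi / 4 - \<theta> else \<theta> - pi / 4)"
    unfolding A by simp
qed

text \<open>Weight coming from \<open>f0\<close>. At u = a + b, v = b - a it equals
  \<open>4 * angle_term e 3 a b\<close>, so its angle is measured from the diagonals. The parameter
  e stands for \<open>E2 \<tau>\<close>.\<close>

definition f_angle :: "complex \<Rightarrow> real \<Rightarrow> real \<Rightarrow> complex" where
  "f_angle e u v = 4 * of_real (sgn (u\<^sup>2 - v\<^sup>2) * arctan \<bar>(u + v) / (u - v)\<bar>) * (of_real ((u + v)\<^sup>2) - e / 18)"

text \<open>Weight coming from \<open>g0\<close>: the difference
  \<open>angle_term e (3/2) v u - angle_term e (3/2) u v\<close>, with angles measured from the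
  axes.\<close>

definition g_angle :: "complex \<Rightarrow> real \<Rightarrow> real \<Rightarrow> complex" where
  "g_angle e u v = of_real (sgn (u * v)) *
     (of_real (arctan \<bar>u / v\<bar>) * (4 * of_real (u\<^sup>2) - e / 9) - of_real (arctan \<bar>v / u\<bar>) * (4 * of_real (v\<^sup>2) - e / 9))"

text \<open>Weight of \<open>Phi\<close> in the coordinates n1 = u - v, n2 = v, where n1 + n2 = u,
  n1 + 2 n2 = u + v and n1 (n1 + 2 n2) = u^2 - v^2.\<close>

definition Phi_weight :: "complex \<Rightarrow> real \<Rightarrow> real \<Rightarrow> complex" where
  "Phi_weight e u v = of_real ((sgn v + sgn u) * sgn (u - v)) * (of_real ((u + v)\<^sup>2) - e / 18)
     + of_real (sgn u * sgn v * (u\<^sup>2 - v\<^sup>2))"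

text \<open>In both cases the coefficient of \<theta> = arctan (v / u) on the left is 4 ((u + v)^2 +
  (u - v)^2 - e / 9) - 2 (4 u^2 + 4 v^2 - 2 e / 9) = 0. What remains comes from the constant parts
  of the angles, multiples of pi / 4. For v < u both sides are pi (4 u^2 + 4 u v - e / 9).\<close>

lemma angle_identity_pos:
  assumes "0 < u" "0 < v" "u \<noteq> v"
  shows "f_angle e u v - f_angle e (- u) v + 2 * g_angle e u v =
         of_real pi * (Phi_weight e u v - Phi_weight e (- u) v)"
proof (cases "v < u")
  case True
  then have "sgn (u\<^sup>2 - v\<^sup>2) = 1" using assms by (simp add: power_strict_mono)
  with True assms show ?thesis
    unfolding f_angle_def g_angle_def Phi_weight_def arctan_ratio[OF assms]
    by (simp add: arctan_ratio[OF assms] algebra_simps power2_eq_square)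
next
  case False
  then have "sgn (u\<^sup>2 - v\<^sup>2) = - 1" using assms power_strict_mono[of u v 2] by simp
  with False assms show ?thesis
    unfolding f_angle_def g_angle_def Phi_weight_def arctan_ratio[OF assms]
    by (simp add: arctan_ratio[OF assms] algebra_simps power2_eq_square)
qed

lemma angle_minus:
  "f_angle e (- u) (- v) = f_angle e u v" "g_angle e (- u) v = - g_angle e u v"
  "g_angle e (- u) (- v) = g_angle e u v" "Phi_weight e (- u) (- v) = Phi_weight e u v"
proof -
  have 1: "\<bar>(- u + - v) / (- u - - v)\<bar> = \<bar>(u + v) / (u - v)\<bar>"
    by (metis abs_minus_cancel minus_add_distrib minus_diff_eq minus_divide_divide minus_diff_minus diff_conv_add_uminus)
  show "f_angle e (- u) (- v) = f_angle e u v"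
    unfolding f_angle_def 1 by (simp add: power2_eq_square algebra_simps)
  show "g_angle e (- u) v = - g_angle e u v" "g_angle e (- u) (- v) = g_angle e u v"
    by (simp_all add: g_angle_def sgn_mult sgn_minus)
  have 2: "sgn (- u - - v) = - sgn (u - v)"
    by (metis minus_diff_minus sgn_minus)
  show "Phi_weight e (- u) (- v) = Phi_weight e u v"
    unfolding Phi_weight_def 2 by (simp add: sgn_minus power2_eq_square algebra_simps)
qed

text \<open>Both sides are odd under u -> - u and invariant under (u, v) -> (- u, - v), so the first
  quadrant suffices.\<close>

lemma angle_identity:
  assumes "u \<noteq> 0" "v \<noteq> 0" "\<bar>u\<bar> \<noteq> \<bar>v\<bar>"
  shows "f_angle e u v - f_angle e (- u) v + 2 * g_angle e u v =
         of_real pi * (Phi_weight e u v - Phi_weight e (- u) v)"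
proof -
  have *: "f_angle e u v - f_angle e (- u) v + 2 * g_angle e u v =
         of_real pi * (Phi_weight e u v - Phi_weight e (- u) v)"
    if "0 < v" "u \<noteq> 0" "\<bar>u\<bar> \<noteq> \<bar>v\<bar>" for u v
  proof (cases "0 < u")
    case True
    then show ?thesis using that by (intro angle_identity_pos) auto
  next
    case False
    then have "f_angle e (- u) v - f_angle e u v + 2 * g_angle e (- u) v =
         of_real pi * (Phi_weight e (- u) v - Phi_weight e u v)"
      using angle_identity_pos[of "- u" v e] that by auto
    then show ?thesis unfolding angle_minus by (simp add: algebra_simps)
  qed
  show ?thesis
  proof (cases "0 < v")
    case True
    then show ?thesis using * assms by simp
  next
    case False
    then show ?thesis
      using *[of "- v" "- u"] assms angle_minus(1)[of e "- u" v] angle_minus(3)[of e "- u" v] angle_minus(4)[of e "- u" v]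
      by (simp add: angle_minus)
  qed
qed

section \<open>Lattice sums\<close>

lemma norm_qexp: "norm (qexp \<tau> x) = exp (- (2 * pi * Im \<tau> * x))"
  by (simp add: qexp_def mult_ac)

lemma qexp_add: "qexp \<tau> (x + y) = qexp \<tau> x * qexp \<tau> y"
  by (simp add: qexp_def ring_distribs exp_add)

lemma summable_on_exp_neg_abs: "(\<lambda>j::int. exp (- \<bar>of_int j\<bar> :: real)) summable_on UNIV"
proof -
  have 1: "(\<lambda>n::nat. exp (- real n)) summable_on UNIV"
  proof -
    have "summable (\<lambda>n::nat. exp (- 1 :: real) ^ n)"
      by (rule summable_geometric) simp
    then show ?thesis
      by (intro norm_summable_imp_summable_on) (simp flip: exp_of_nat_mult)
  qed
  have "(\<lambda>j::int. exp (- \<bar>of_int j\<bar> :: real)) summable_on {0..}"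
    by (rule summable_on_reindex_bij_witness[of _ int nat, THEN iffD2, OF _ _ _ _ _ 1]) auto
  moreover have "(\<lambda>j::int. exp (- \<bar>of_int j\<bar> :: real)) summable_on {..<0}"
    by (rule summable_on_subset_banach[of _ "{..0}"],
        rule summable_on_reindex_bij_witness[of _ "\<lambda>n. - int n" "\<lambda>j. nat (- j)", THEN iffD2, OF _ _ _ _ _ 1]) auto
  ultimately have "(\<lambda>j::int. exp (- \<bar>of_int j\<bar> :: real)) summable_on {0..} \<union> {..<0}"
    by (rule summable_on_Un_disjoint) auto
  moreover have "{0..} \<union> {..<0::int} = UNIV" by auto
  ultimately show ?thesis by simp
qed

text \<open>With y = |j + r| the power is absorbed by y^N \<le> N! exp y, and the Gaussian dominates
  exp (2 y) up to a constant, which leaves a multiple of exp (- |j|).\<close>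

lemma summable_on_gauss:
  fixes r \<kappa> :: real
  assumes "0 < \<kappa>"
  shows "(\<lambda>j::int. \<bar>of_int j + r\<bar> ^ N * exp (- (\<kappa> * (of_int j + r)\<^sup>2))) summable_on UNIV"
proof (rule summable_on_comparison_test)
  show "(\<lambda>j::int. exp (- \<bar>of_int j\<bar> :: real) * (fact N * exp (1 / \<kappa> + \<bar>r\<bar>))) summable_on UNIV"
    by (intro summable_on_cmult_left summable_on_exp_neg_abs)
  fix j :: int
  define y where "y = \<bar>of_int j + r\<bar>"
  have "y ^ N / fact N \<le> exp y"
  proof -
    have "(\<Sum>n\<in>{N}. y ^ n /\<^sub>R fact n) \<le> exp y"
      unfolding exp_def using summable_exp_generic[of y] by (rule sum_le_suminf) (auto simp: y_def)
    then show ?thesis by (simp add: divide_inverse mult.commute)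
  qed
  then have "y ^ N \<le> fact N * exp y"
    by (simp add: field_simps)
  then have "y ^ N * exp (- (\<kappa> * y\<^sup>2)) \<le> fact N * (exp y * exp (- (\<kappa> * y\<^sup>2)))"
    by (simp add: mult_right_mono flip: mult.assoc)
  also have "exp y * exp (- (\<kappa> * y\<^sup>2)) \<le> exp (- \<bar>of_int j\<bar>) * exp (1 / \<kappa> + \<bar>r\<bar>)"
  proof -
    \<comment> \<open>Completing the square: 2 y - \<kappa> y^2 \<le> 1 / \<kappa>. One y pays for
      the factor exp y, the other yields the decay exp (- y).\<close>
    have "0 \<le> (\<kappa> * y - 1)\<^sup>2 / \<kappa>" using assms by simp
    also have "\<dots> = \<kappa> * y\<^sup>2 - 2 * y + 1 / \<kappa>"
      using assms by (simp add: power2_eq_square field_simps)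
    finally have "2 * y - \<kappa> * y\<^sup>2 \<le> 1 / \<kappa>" by simp
    moreover have "\<bar>of_int j\<bar> - \<bar>r\<bar> \<le> y" unfolding y_def by arith
    ultimately show ?thesis by (simp flip: exp_add)
  qed
  finally show "\<bar>of_int j + r\<bar> ^ N * exp (- (\<kappa> * (of_int j + r)\<^sup>2)) \<le>
      exp (- \<bar>of_int j\<bar>) * (fact N * exp (1 / \<kappa> + \<bar>r\<bar>))"
    by (simp add: y_def mult_left_mono mult_ac)
qed auto

lemma summable_on_qexp:
  assumes "0 < Im \<tau>" "0 < m"
  shows "(\<lambda>j::int. \<bar>of_int j + r\<bar> ^ N * norm (qexp \<tau> (m * (of_int j + r)\<^sup>2))) summable_on UNIV"
  using summable_on_gauss[of "2 * pi * Im \<tau> * m" r N] assms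
  by (simp add: norm_qexp mult.assoc)

text \<open>Contribution of one pair of exponents x, y to the double integral of a product of two
  theta series of index m, up to its sign character and power of q; see
  \<open>theta_pair_integral\<close>.\<close>

definition angle_term :: "complex \<Rightarrow> real \<Rightarrow> real \<Rightarrow> real \<Rightarrow> complex" where
  "angle_term e m x y = of_real (sgn (x * y) * arctan \<bar>y / x\<bar>) * (4 * of_real (y\<^sup>2) - e / of_real (6 * m))"

lemma minus_one_powi_even: "(- 1 :: complex) powi (2 * l) = 1"
  by (simp add: power_int_mult)

text \<open>With n1 = u - v and n2 = v the shifts (1/3, 1/6) become (1/2, 1/6), the sign (-1)^(n1 -
  1/3) becomes (-1)^(j - k), and the quadratic form is diagonal: 3/2 (u^2 + v^2).\<close>

definition lattice_sum_term :: "complex \<Rightarrow> complex \<Rightarrow> (complex \<Rightarrow> real \<Rightarrow> real \<Rightarrow> complex) \<Rightarrow> int \<times> int \<Rightarrow> complex" where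
  "lattice_sum_term \<tau> e w = (\<lambda>(j, k). (- 1) powi (j - k) * w e (of_int j + 1/2) (of_int k + 1/6)
     * qexp \<tau> (3/2 * ((of_int j + 1/2)\<^sup>2 + (of_int k + 1/6)\<^sup>2)))"

text \<open>The lattice splits by the parity of j - k. Even points are (u, v) = (a + b, b - a) with
  a in Z + 1/6 and b in Z + 1/3, and then 3/2 (u^2 + v^2) = 3 (a^2 + b^2). On odd points a and b
  exchange roles and the sign is - 1. The two classes correspond to the two products in
  \<open>f0\<close>.\<close>

lemma f_angle_has_sum:
  assumes x: "((\<lambda>(j, k). angle_term e 3 (of_int j + 1/6) (of_int k + 1/3)
      * qexp \<tau> (3 * ((of_int j + 1/6)\<^sup>2 + (of_int k + 1/3)\<^sup>2))) has_sum x) UNIV"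
    and y: "((\<lambda>(j, k). angle_term e 3 (of_int j + 1/3) (of_int k + 1/6)
      * qexp \<tau> (3 * ((of_int j + 1/3)\<^sup>2 + (of_int k + 1/6)\<^sup>2))) has_sum y) UNIV"
  shows "(lattice_sum_term \<tau> e f_angle has_sum 4 * x - 4 * y) UNIV"
proof -
  have even: "(lattice_sum_term \<tau> e f_angle has_sum 4 * x) {(j, k). even (j - k)}"
  proof (rule has_sum_reindex_bij_witness[THEN iffD1, OF _ _ _ _ _ _ has_sum_cmult_right[OF x, of 4],
        of "\<lambda>(j, k). ((j - k) div 2, (j + k) div 2)" "\<lambda>(l, k). (k + l, k - l)"])
    fix p :: "int \<times> int"
    obtain l k where p: "p = (l, k)" by force
    define a b :: real where "a = of_int l + 1/6" and "b = of_int k + 1/3"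
    have u: "of_int (k + l) + 1/2 = a + b" "of_int (k - l) + 1/6 = b - a"
      by (simp_all add: a_def b_def)
    have 1: "(a + b)\<^sup>2 - (b - a)\<^sup>2 = 4 * (a * b)" "a + b + (b - a) = 2 * b" "a + b - (b - a) = 2 * a"
      "3 / 2 * ((a + b)\<^sup>2 + (b - a)\<^sup>2) = 3 * (a\<^sup>2 + b\<^sup>2)"
      by (simp_all add: power2_eq_square algebra_simps)
    have 2: "(k + l) - (k - l) = 2 * l" by simp
    show "lattice_sum_term \<tau> e f_angle (case p of (l, k) \<Rightarrow> (k + l, k - l)) =
        4 * (case p of (j, k) \<Rightarrow> angle_term e 3 (of_int j + 1/6) (of_int k + 1/3)
      * qexp \<tau> (3 * ((of_int j + 1/6)\<^sup>2 + (of_int k + 1/3)\<^sup>2)))"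
      unfolding p lattice_sum_term_def prod.case f_angle_def angle_term_def u 1 2 minus_one_powi_even
        a_def[symmetric] b_def[symmetric]
      by (simp add: sgn_mult power_mult_distrib)
  qed (auto, presburger+)
  \<comment> \<open>Odd points are (u, v) = (- a - b, b - a) with a = m + 1/6, b = l + 1/3; the - 1
    in the witness reflects - 1/2 = - 1 + 1/2.\<close>
  have odd: "(lattice_sum_term \<tau> e f_angle has_sum - 4 * y) {(j, k). odd (j - k)}"
  proof (rule has_sum_reindex_bij_witness[THEN iffD1, OF _ _ _ _ _ _ has_sum_cmult_right[OF y, of "- 4"],
        of "\<lambda>(j, k). ((k - j - 1) div 2, - (j + k + 1) div 2)" "\<lambda>(l, m). (- (m + l) - 1, l - m)"])
    fix p :: "int \<times> int"
    obtain l m where p: "p = (l, m)" by force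
    define a b :: real where "a = of_int m + 1/6" and "b = of_int l + 1/3"
    have u: "of_int (- (m + l) - 1) + 1/2 = - a - b" "of_int (l - m) + 1/6 = b - a"
      by (simp_all add: a_def b_def)
    have 1: "(- a - b)\<^sup>2 - (b - a)\<^sup>2 = 4 * (b * a)" "- a - b + (b - a) = - 2 * a" "- a - b - (b - a) = - 2 * b"
      "3 / 2 * ((- a - b)\<^sup>2 + (b - a)\<^sup>2) = 3 * (b\<^sup>2 + a\<^sup>2)"
      by (simp_all add: power2_eq_square algebra_simps)
    have 2: "(- (m + l) - 1) - (l - m) = 2 * (- l - 1) + 1" by simp
    have 3: "(- 1 :: complex) powi (2 * (- l - 1) + 1) = - 1"
      by (subst power_int_add) (simp_all only: minus_one_powi_even, auto)
    show "lattice_sum_term \<tau> e f_angle (case p of (l, m) \<Rightarrow> (- (m + l) - 1, l - m)) =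
        - 4 * (case p of (j, k) \<Rightarrow> angle_term e 3 (of_int j + 1/3) (of_int k + 1/6)
      * qexp \<tau> (3 * ((of_int j + 1/3)\<^sup>2 + (of_int k + 1/6)\<^sup>2)))"
      unfolding p lattice_sum_term_def prod.case f_angle_def angle_term_def u 1 2 3
        a_def[symmetric] b_def[symmetric]
      by (simp add: sgn_mult power_mult_distrib)
  qed (auto, presburger+)
  have "{(j, k). even (j - k)} \<union> {(j, k). odd (j - k)} = (UNIV :: (int \<times> int) set)" by auto
  then show ?thesis
    using has_sum_Un_disjoint[OF even odd] by fastforce
qed

text \<open>Each half of \<open>g_angle\<close> is summed over the whole lattice. The reflection k
  -> - k - 1 turns the shift 1/6 into 5/6 with v negated; the sign change of sgn (u v) cancels that
  of (-1)^(j - k). The first half also exchanges the coordinates.\<close>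

lemma g_angle_has_sum:
  assumes x: "((\<lambda>(j, k). (- 1) powi (j + k) * angle_term e (3/2) (of_int j + 5/6) (of_int k + 1/2)
      * qexp \<tau> (3/2 * ((of_int j + 5/6)\<^sup>2 + (of_int k + 1/2)\<^sup>2))) has_sum x) UNIV"
    and y: "((\<lambda>(j, k). (- 1) powi (j + k) * angle_term e (3/2) (of_int j + 1/2) (of_int k + 5/6)
      * qexp \<tau> (3/2 * ((of_int j + 1/2)\<^sup>2 + (of_int k + 5/6)\<^sup>2))) has_sum y) UNIV"
  shows "(lattice_sum_term \<tau> e g_angle has_sum x - y) UNIV"
proof -
  define w1 w2 where "w1 e u v = of_real (sgn (u * v)) * (of_real (arctan \<bar>u / v\<bar>) * (4 * of_real (u\<^sup>2) - e / 9))"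
    and "w2 e u v = of_real (sgn (u * v)) * (of_real (arctan \<bar>v / u\<bar>) * (4 * of_real (v\<^sup>2) - e / 9))"
    for e :: complex and u v
  have r: "of_int (- k - 1) + 1/6 = - (of_int k + 5/6 :: real)" for k
    by simp
  have s: "(- 1 :: complex) powi (j - (- k - 1)) = - ((- 1) powi (k + j))" for j k
  proof -
    have 1: "j - (- k - 1) = k + j + 1" by simp
    have "(- 1 :: complex) powi (k + j + 1) = (- 1) powi (k + j) * (- 1) powi 1"
      by (rule power_int_add) simp
    then show ?thesis
      unfolding 1 by simp
  qed
  have "(lattice_sum_term \<tau> e w1 has_sum x) UNIV"
  proof (rule has_sum_reindex_bij_witness[THEN iffD1, OF _ _ _ _ _ _ x,
        of "\<lambda>(j, k). (- k - 1, j)" "\<lambda>(j, k). (k, - j - 1)"])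
    fix p :: "int \<times> int"
    obtain j k where p: "p = (j, k)" by force
    show "lattice_sum_term \<tau> e w1 (case p of (j, k) \<Rightarrow> (k, - j - 1)) =
       (case p of (j, k) \<Rightarrow> (- 1) powi (j + k) * angle_term e (3/2) (of_int j + 5/6) (of_int k + 1/2)
      * qexp \<tau> (3/2 * ((of_int j + 5/6)\<^sup>2 + (of_int k + 1/2)\<^sup>2)))"
      unfolding p lattice_sum_term_def prod.case w1_def angle_term_def r s
      by (simp add: sgn_mult sgn_minus power_mult_distrib add.commute mult_ac del: minus_add_distrib)
  qed auto
  moreover have "(lattice_sum_term \<tau> e w2 has_sum y) UNIV"
  proof (rule has_sum_reindex_bij_witness[THEN iffD1, OF _ _ _ _ _ _ y,
        of "\<lambda>(j, k). (j, - k - 1)" "\<lambda>(j, k). (j, - k - 1)"])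
    fix p :: "int \<times> int"
    obtain j k where p: "p = (j, k)" by force
    show "lattice_sum_term \<tau> e w2 (case p of (j, k) \<Rightarrow> (j, - k - 1)) =
       (case p of (j, k) \<Rightarrow> (- 1) powi (j + k) * angle_term e (3/2) (of_int j + 1/2) (of_int k + 5/6)
      * qexp \<tau> (3/2 * ((of_int j + 1/2)\<^sup>2 + (of_int k + 5/6)\<^sup>2)))"
      unfolding p lattice_sum_term_def prod.case w2_def angle_term_def r s
      by (simp add: sgn_mult sgn_minus power_mult_distrib add.commute mult_ac del: minus_add_distrib)
  qed auto
  ultimately have "((\<lambda>p. lattice_sum_term \<tau> e w1 p - lattice_sum_term \<tau> e w2 p) has_sum x - y) UNIV"
    using has_sum_add[OF _ has_sum_cmult_right[of _ _ _ "- 1"]] by fastforce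
  moreover have "(\<lambda>p. lattice_sum_term \<tau> e w1 p - lattice_sum_term \<tau> e w2 p) = lattice_sum_term \<tau> e g_angle"
    by (auto simp: fun_eq_iff lattice_sum_term_def w1_def w2_def g_angle_def algebra_simps)
  ultimately show ?thesis by simp
qed

text \<open>The bound on the weight and the diagonal exponent both factor, so a product of two
  one-dimensional Gaussian sums is a majorant.\<close>

lemma lattice_sum_term_summable:
  assumes \<tau>: "0 < Im \<tau>" and w: "\<And>u v. norm (w e u v) \<le> K * ((1 + u\<^sup>2) * (1 + v\<^sup>2))"
  shows "lattice_sum_term \<tau> e w summable_on UNIV"
proof -
  have c: "(\<lambda>j::int. norm (of_real (1 + (of_int j + r)\<^sup>2) * qexp \<tau> (3/2 * (of_int j + r)\<^sup>2))) summable_on UNIV" for r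
  proof -
    have "(\<lambda>j::int. \<bar>of_int j + r\<bar> ^ 0 * norm (qexp \<tau> (3/2 * (of_int j + r)\<^sup>2))
        + \<bar>of_int j + r\<bar> ^ 2 * norm (qexp \<tau> (3/2 * (of_int j + r)\<^sup>2))) summable_on UNIV"
      using \<tau> by (intro summable_on_add summable_on_qexp) auto
    moreover have "norm (of_real (1 + (of_int j + r)\<^sup>2) * qexp \<tau> (3/2 * (of_int j + r)\<^sup>2)) =
        \<bar>of_int j + r\<bar> ^ 0 * norm (qexp \<tau> (3/2 * (of_int j + r)\<^sup>2))
        + \<bar>of_int j + r\<bar> ^ 2 * norm (qexp \<tau> (3/2 * (of_int j + r)\<^sup>2))" for j :: int
      unfolding norm_mult norm_of_real by (simp add: algebra_simps abs_of_nonneg)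
    ultimately show ?thesis by simp
  qed
  have "(\<lambda>p. norm (lattice_sum_term \<tau> e w p)) summable_on UNIV"
  proof (rule summable_on_comparison_test)
    show "(\<lambda>p. K * (case p of (j, k) \<Rightarrow> norm ((of_real (1 + (of_int j + 1/2)\<^sup>2) * qexp \<tau> (3/2 * (of_int j + 1/2)\<^sup>2)) *
        (of_real (1 + (of_int k + 1/6)\<^sup>2) * qexp \<tau> (3/2 * (of_int k + 1/6)\<^sup>2))))) summable_on UNIV"
      by (intro summable_on_cmult_right infsum_mult_infsum(1) c)
    fix p :: "int \<times> int"
    obtain j k where p: "p = (j, k)" by force
    define u v :: real where "u = of_int j + 1/2" and "v = of_int k + 1/6"
    have 1: "norm (complex_of_real (1 + x\<^sup>2)) = 1 + x\<^sup>2" for x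
      unfolding norm_of_real by (simp add: abs_of_nonneg)
    have "norm (w e u v) * norm (qexp \<tau> (3/2 * (u\<^sup>2 + v\<^sup>2))) \<le>
        K * ((1 + u\<^sup>2) * (1 + v\<^sup>2)) * norm (qexp \<tau> (3/2 * (u\<^sup>2 + v\<^sup>2)))"
      by (intro mult_right_mono w) auto
    moreover have "norm ((- 1 :: complex) powi (j - k)) = 1"
      by (simp add: norm_power_int)
    ultimately show "norm (lattice_sum_term \<tau> e w p) \<le> K * (case p of (j, k) \<Rightarrow> norm ((of_real (1 + (of_int j + 1/2)\<^sup>2) * qexp \<tau> (3/2 * (of_int j + 1/2)\<^sup>2)) *
        (of_real (1 + (of_int k + 1/6)\<^sup>2) * qexp \<tau> (3/2 * (of_int k + 1/6)\<^sup>2))))"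
      unfolding p lattice_sum_term_def prod.case u_def[symmetric] v_def[symmetric] norm_mult 1
        distrib_left[of "3/2"] qexp_add
      by (simp only: mult_1_left mult_ac)
  qed auto
  then show ?thesis by (rule abs_summable_summable)
qed

lemma Phi_has_sum:
  assumes "0 < Im \<tau>"
  shows "(lattice_sum_term \<tau> (E2 \<tau>) Phi_weight has_sum Phi \<tau>) UNIV"
proof -
  define w1 w2 :: "complex \<Rightarrow> real \<Rightarrow> real \<Rightarrow> complex"
    where "w1 e u v = of_real ((sgn v + sgn u) * sgn (u - v)) * (of_real ((u + v)\<^sup>2) - e / 18)"
      and "w2 e u v = of_real (sgn u * sgn v * (u\<^sup>2 - v\<^sup>2))" for e u v
  have coord: "real_of_int (j - k) + 1/3 = (of_int j + 1/2) - (of_int k + 1/6)" for j k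
    by simp
  have diff: "u - v + v = u" "u - v + 2 * v = u + v" "QB (u - v) v = 3/2 * (u\<^sup>2 + v\<^sup>2)" for u v
    by (simp_all add: QB_def power2_eq_square field_simps)
  have Phi1: "Phi1 \<tau> = (\<Sum>\<^sub>\<infinity>p. lattice_sum_term \<tau> (E2 \<tau>) w1 p)"
    unfolding Phi1_def
  proof (rule infsum_reindex_bij_witness[of _ "\<lambda>(j, k). (j - k, k)" "\<lambda>(a, b). (a + b, b)"])
    fix p :: "int \<times> int"
    obtain a k where p: "p = (a, k)" by force
    define j where "j = a + k"
    have a: "a = j - k" by (simp add: j_def)
    show "lattice_sum_term \<tau> (E2 \<tau>) w1 (case p of (a, b) \<Rightarrow> (a + b, b)) = (case p of (a, b) \<Rightarrow>
      let n1 = real_of_int a + 1/3; n2 = real_of_int b + 1/6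
      in (-1) powi a * of_real ((sgn n2 + sgn (n1 + n2)) * sgn n1)
         * (of_real ((n1 + 2 * n2)^2) - E2 \<tau> / 18) * qexp \<tau> (QB n1 n2))"
      unfolding p prod.case Let_def j_def[symmetric] unfolding a coord diff lattice_sum_term_def prod.case w1_def
      by (simp only: mult.assoc)
  qed auto
  have Phi2: "Phi2 \<tau> = (\<Sum>\<^sub>\<infinity>p. lattice_sum_term \<tau> (E2 \<tau>) w2 p)"
    unfolding Phi2_def
  proof (rule infsum_reindex_bij_witness[of _ "\<lambda>(j, k). (j - k, k)" "\<lambda>(a, b). (a + b, b)"])
    fix p :: "int \<times> int"
    obtain a k where p: "p = (a, k)" by force
    define j where "j = a + k"
    have a: "a = j - k" by (simp add: j_def)
    have sq: "x * y * (u - v) * (u + v) = x * y * (u\<^sup>2 - v\<^sup>2)" for x y u v :: real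
      by (simp add: power2_eq_square algebra_simps)
    show "lattice_sum_term \<tau> (E2 \<tau>) w2 (case p of (a, b) \<Rightarrow> (a + b, b)) = (case p of (a, b) \<Rightarrow>
      let n1 = real_of_int a + 1/3; n2 = real_of_int b + 1/6
      in (-1) powi a * of_real (sgn (n1 + n2) * sgn n2 * n1 * (n1 + 2 * n2)) * qexp \<tau> (QB n1 n2))"
      unfolding p prod.case Let_def j_def[symmetric] unfolding a coord diff lattice_sum_term_def prod.case w2_def sq ..
  qed auto
  have uv: "(u + v)\<^sup>2 \<le> 2 * ((1 + u\<^sup>2) * (1 + v\<^sup>2))" "\<bar>u\<^sup>2 - v\<^sup>2\<bar> \<le> 1 * ((1 + u\<^sup>2) * (1 + v\<^sup>2))" "1 \<le> (1 + u\<^sup>2) * (1 + v\<^sup>2)"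
    for u v :: real
  proof -
    have "(1 + u\<^sup>2) * (1 + v\<^sup>2) = 1 + u\<^sup>2 + v\<^sup>2 + u\<^sup>2 * v\<^sup>2" "0 \<le> u\<^sup>2 * v\<^sup>2" "0 \<le> u\<^sup>2" "0 \<le> v\<^sup>2"
      by (simp_all add: algebra_simps)
    moreover have "(u + v)\<^sup>2 \<le> 2 * u\<^sup>2 + 2 * v\<^sup>2"
      using zero_le_power2[of "u - v"] by (simp add: power2_sum power2_diff)
    ultimately show "(u + v)\<^sup>2 \<le> 2 * ((1 + u\<^sup>2) * (1 + v\<^sup>2))" "\<bar>u\<^sup>2 - v\<^sup>2\<bar> \<le> 1 * ((1 + u\<^sup>2) * (1 + v\<^sup>2))" "1 \<le> (1 + u\<^sup>2) * (1 + v\<^sup>2)"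
      by linarith+
  qed
  have sgn1: "\<bar>sgn x\<bar> \<le> 1" for x :: real by (simp add: sgn_if)
  \<comment> \<open>The reindexings above only equate values of \<open>infsum\<close>; adding the
    two sums termwise requires actual summability.\<close>
  have s1: "lattice_sum_term \<tau> (E2 \<tau>) w1 summable_on UNIV"
  proof (rule lattice_sum_term_summable[OF assms])
    fix u v :: real
    have "\<bar>sgn v + sgn u\<bar> \<le> 2"
      using sgn1[of u] sgn1[of v] by linarith
    then have "\<bar>(sgn v + sgn u) * sgn (u - v)\<bar> \<le> 2 * 1"
      unfolding abs_mult by (intro mult_mono sgn1) auto
    moreover have "norm (of_real ((u + v)\<^sup>2) - E2 \<tau> / 18) \<le> (2 + norm (E2 \<tau>)) * ((1 + u\<^sup>2) * (1 + v\<^sup>2))"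
    proof -
      have "norm (of_real ((u + v)\<^sup>2) - E2 \<tau> / 18) \<le> (u + v)\<^sup>2 + norm (E2 \<tau>) / 18"
        by (rule order_trans[OF norm_triangle_ineq4]) (simp only: norm_of_real norm_divide, simp)
      also have "\<dots> \<le> 2 * ((1 + u\<^sup>2) * (1 + v\<^sup>2)) + norm (E2 \<tau>) * ((1 + u\<^sup>2) * (1 + v\<^sup>2))"
        using uv(1)[of u v] mult_left_mono[OF uv(3)[of u v] norm_ge_zero[of "E2 \<tau>"]] norm_ge_zero[of "E2 \<tau>"]
        by linarith
      finally show ?thesis by (simp only: distrib_right)
    qed
    ultimately have "norm (w1 (E2 \<tau>) u v) \<le> (2 * 1) * ((2 + norm (E2 \<tau>)) * ((1 + u\<^sup>2) * (1 + v\<^sup>2)))"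
      unfolding w1_def norm_mult norm_of_real by (intro mult_mono) auto
    then show "norm (w1 (E2 \<tau>) u v) \<le> (2 * 1 * (2 + norm (E2 \<tau>))) * ((1 + u\<^sup>2) * (1 + v\<^sup>2))"
      by (simp only: mult.assoc)
  qed
  have s2: "lattice_sum_term \<tau> (E2 \<tau>) w2 summable_on UNIV"
  proof (rule lattice_sum_term_summable[OF assms])
    fix u v :: real
    have "\<bar>sgn u * sgn v\<bar> * \<bar>u\<^sup>2 - v\<^sup>2\<bar> \<le> 1 * \<bar>u\<^sup>2 - v\<^sup>2\<bar>"
      by (intro mult_right_mono) (auto simp: abs_mult sgn_if)
    then show "norm (w2 (E2 \<tau>) u v) \<le> 1 * ((1 + u\<^sup>2) * (1 + v\<^sup>2))"
      unfolding w2_def norm_of_real abs_mult[of "_ * _"] using order_trans[OF _ uv(2)[of u v]] by simp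
  qed
  have "((\<lambda>p. lattice_sum_term \<tau> (E2 \<tau>) w1 p + lattice_sum_term \<tau> (E2 \<tau>) w2 p) has_sum Phi \<tau>) UNIV"
    unfolding Phi_def Phi1 Phi2 by (intro has_sum_add has_sum_infsum s1 s2)
  moreover have "(\<lambda>p. lattice_sum_term \<tau> (E2 \<tau>) w1 p + lattice_sum_term \<tau> (E2 \<tau>) w2 p) =
      lattice_sum_term \<tau> (E2 \<tau>) Phi_weight"
    by (auto simp: fun_eq_iff lattice_sum_term_def w1_def w2_def Phi_weight_def algebra_simps)
  ultimately show ?thesis by simp
qed

text \<open>The reflection \<open>u \<mapsto> - u\<close> of the lattice reverses the sign \<open>(- 1) ^ (j - k)\<close>, so only the
  parts of the weights that are odd in \<open>u\<close> contribute; for these the arctangents cancel.\<close>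

lemma Phi_eq_angle_sums:
  assumes \<tau>: "0 < Im \<tau>"
    and f: "(lattice_sum_term \<tau> (E2 \<tau>) f_angle has_sum x) UNIV"
    and g: "(lattice_sum_term \<tau> (E2 \<tau>) g_angle has_sum y) UNIV"
  shows "x + y = of_real pi * Phi \<tau>"
proof -
  define T where "T = lattice_sum_term \<tau> (E2 \<tau>)"
  \<comment> \<open>The map is - j - 1 because the coordinate is j + 1/2.\<close>
  define \<rho> :: "int \<times> int \<Rightarrow> int \<times> int" where "\<rho> = (\<lambda>(j, k). (- j - 1, k))"
  have refl: "((\<lambda>p. T w (\<rho> p)) has_sum s) UNIV" if "(T w has_sum s) UNIV" for w s
    by (rule has_sum_reindex_bij_witness[THEN iffD2, OF _ _ _ _ _ _ that, of _ \<rho> \<rho>]) (auto simp: \<rho>_def)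
  note P = Phi_has_sum[OF \<tau>, folded T_def]
  note f = f[folded T_def] and g = g[folded T_def]
  \<comment> \<open>Adding the reflected family doubles the value of the sum. The
    \<open>g_angle\<close> term is itself invariant under \<rho>, since its weight and its sign both
    change sign, so it is simply multiplied by 2.\<close>
  have "((\<lambda>p. (T f_angle p + T f_angle (\<rho> p)) + 2 * T g_angle p) has_sum (x + x) + 2 * y) UNIV"
    by (intro has_sum_add has_sum_cmult_right f refl[OF f] g)
  moreover have "((\<lambda>p. of_real pi * (T Phi_weight p + T Phi_weight (\<rho> p))) has_sum of_real pi * (Phi \<tau> + Phi \<tau>)) UNIV"
    by (intro has_sum_add has_sum_cmult_right P refl[OF P])
  moreover have "(T f_angle p + T f_angle (\<rho> p)) + 2 * T g_angle p = of_real pi * (T Phi_weight p + T Phi_weight (\<rho> p))" for p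
  proof -
    obtain j k where p: "p = (j, k)" by force
    define u v :: real where "u = of_int j + 1/2" and "v = of_int k + 1/6"
    \<comment> \<open>Lattice points avoid the axes and the diagonals: 2 j + 1 is odd, 6 k + 1 is
      nonzero, and 6 j + 3 is divisible by 3 while 6 k + 1 is not.\<close>
    have ne: "u \<noteq> 0" "v \<noteq> 0" "\<bar>u\<bar> \<noteq> \<bar>v\<bar>"
    proof -
      have "2 * j + 1 \<noteq> 0" "6 * k + 1 \<noteq> 0" "6 * j + 3 \<noteq> 6 * k + 1" "6 * j + 3 \<noteq> - (6 * k + 1)" by presburger+
      then have "real_of_int (2 * j + 1) \<noteq> 0" "real_of_int (6 * k + 1) \<noteq> 0"
        "real_of_int (6 * j + 3) \<noteq> real_of_int (6 * k + 1)" "real_of_int (6 * j + 3) \<noteq> real_of_int (- (6 * k + 1))"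
        by (simp_all only: of_int_eq_iff of_int_eq_0_iff not_False_eq_True)
      then show "u \<noteq> 0" "v \<noteq> 0" "\<bar>u\<bar> \<noteq> \<bar>v\<bar>" by (auto simp: u_def v_def abs_eq_iff)
    qed
    have u': "of_int (- j - 1) + 1/2 = - u" by (simp add: u_def)
    have s: "(- 1 :: complex) powi (- j - 1 - k) = - ((- 1) powi (j - k))"
    proof -
      have "- j - 1 - k = (j - k) + 2 * (- j - 1) + 1" by simp
      then have "(- 1 :: complex) powi (- j - 1 - k) = (- 1) powi ((j - k) + 2 * (- j - 1)) * (- 1) powi 1"
        by (simp only:) (rule power_int_add, simp)
      also have "(- 1 :: complex) powi ((j - k) + 2 * (- j - 1)) = (- 1) powi (j - k) * (- 1) powi (2 * (- j - 1))"
        by (rule power_int_add) simp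
      finally show ?thesis by (simp only: minus_one_powi_even) simp
    qed
    define z where "z = (- 1) powi (j - k) * qexp \<tau> (3/2 * (u\<^sup>2 + v\<^sup>2))"
    have T1: "T w p = z * w (E2 \<tau>) u v" and T2: "T w (\<rho> p) = - (z * w (E2 \<tau>) (- u) v)" for w
      unfolding p \<rho>_def prod.case T_def lattice_sum_term_def u' s z_def u_def[symmetric] v_def[symmetric]
      by (simp_all add: mult_ac)
    have "z * (f_angle (E2 \<tau>) u v - f_angle (E2 \<tau>) (- u) v + 2 * g_angle (E2 \<tau>) u v) =
         z * (of_real pi * (Phi_weight (E2 \<tau>) u v - Phi_weight (E2 \<tau>) (- u) v))"
      unfolding angle_identity[OF ne] ..
    then show ?thesis unfolding T1 T2 by (simp add: algebra_simps)
  qed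
  ultimately have "(x + x) + 2 * y = of_real pi * (Phi \<tau> + Phi \<tau>)"
    using has_sum_unique by (metis (no_types, lifting) ext)
  then have "2 * (x + y) = 2 * (of_real pi * Phi \<tau>)" by (simp add: algebra_simps)
  then show ?thesis unfolding mult_cancel_left by simp
qed

section \<open>Theta functions on a vertical ray\<close>

text \<open>Along \<tau> + i s each power of q is its value at \<tau> times a real decaying
  exponential in s. The value at \<tau> goes into this coefficient, the decay into
  \<open>theta_rate\<close>; \<sigma> is 1 for integral and - 1 for half-integral index m.\<close>

definition theta_coeff :: "complex \<Rightarrow> complex \<Rightarrow> real \<Rightarrow> real \<Rightarrow> int \<Rightarrow> complex" where
  "theta_coeff \<tau> \<sigma> m r j = \<sigma> powi j * of_real (of_int j + r) * qexp \<tau> (m * (of_int j + r)\<^sup>2)"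

definition theta_rate :: "real \<Rightarrow> real \<Rightarrow> int \<Rightarrow> real" where
  "theta_rate m r j = 2 * pi * m * (of_int j + r)\<^sup>2"

definition theta_ray :: "complex \<Rightarrow> complex \<Rightarrow> real \<Rightarrow> real \<Rightarrow> real \<Rightarrow> complex" where
  "theta_ray \<tau> \<sigma> m r s = (\<Sum>\<^sub>\<infinity>j. theta_coeff \<tau> \<sigma> m r j * of_real (exp (- theta_rate m r j * s)))"

definition theta_ray_deriv :: "complex \<Rightarrow> complex \<Rightarrow> real \<Rightarrow> real \<Rightarrow> real \<Rightarrow> complex" where
  "theta_ray_deriv \<tau> \<sigma> m r s =
    (\<Sum>\<^sub>\<infinity>j. - (theta_coeff \<tau> \<sigma> m r j * of_real (theta_rate m r j)) * of_real (exp (- theta_rate m r j * s)))"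

text \<open>The shifts are r / (2 m) = 1/6, 1/3 for m = 3, and r / 3 + 1/2 = 5/6, 1/2 for m =
  3/2.\<close>

lemma theta_eq_theta_ray:
  "theta 1 3 1 (\<tau> + \<i> * of_real s) = theta_ray \<tau> 1 3 (1/6) s"
  "theta 1 3 2 (\<tau> + \<i> * of_real s) = theta_ray \<tau> 1 3 (1/3) s"
  "theta 1 (3/2) 1 (\<tau> + \<i> * of_real s) = theta_ray \<tau> (- 1) (3/2) (5/6) s"
  "theta 1 (3/2) 0 (\<tau> + \<i> * of_real s) = theta_ray \<tau> (- 1) (3/2) (1/2) s"
proof -
  have q: "qexp (\<tau> + \<i> * of_real s) (m * x\<^sup>2) = qexp \<tau> (m * x\<^sup>2) * of_real (exp (- (2 * pi * m * x\<^sup>2) * s))" for m x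
    unfolding qexp_def exp_of_real[symmetric] exp_add[symmetric]
    by (rule arg_cong[of _ _ exp]) (simp add: algebra_simps)
  have 3: "(3 :: real) \<in> \<int>" by simp
  have 32: "(3 / 2 :: real) \<notin> \<int>"
  proof
    assume "(3 / 2 :: real) \<in> \<int>"
    then obtain n :: int where "3 / 2 = real_of_int n" by (auto elim: Ints_cases)
    then have "real_of_int 3 = real_of_int (2 * n)" by simp
    then have "3 = 2 * n" by (simp only: of_int_eq_iff)
    then show False by presburger
  qed
  show "theta 1 3 1 (\<tau> + \<i> * of_real s) = theta_ray \<tau> 1 3 (1/6) s"
    "theta 1 3 2 (\<tau> + \<i> * of_real s) = theta_ray \<tau> 1 3 (1/3) s"
    unfolding theta_def theta_ray_def theta_coeff_def theta_rate_def Let_def q if_P[OF 3]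
    by (simp_all add: mult.assoc)
  have add: "real_of_int j + of_int 1 / (2 * (3 / 2)) + 1 / 2 = of_int j + 5 / 6"
      "real_of_int j + of_int 0 / (2 * (3 / 2)) + 1 / 2 = of_int j + 1 / 2" for j
    by simp_all
  show "theta 1 (3/2) 1 (\<tau> + \<i> * of_real s) = theta_ray \<tau> (- 1) (3/2) (5/6) s"
    "theta 1 (3/2) 0 (\<tau> + \<i> * of_real s) = theta_ray \<tau> (- 1) (3/2) (1/2) s"
    unfolding theta_def theta_ray_def theta_coeff_def theta_rate_def Let_def q if_not_P[OF 32] add power_one_right
    by (simp_all only: mult.assoc)
qed

lemma theta_coeff_summable:
  assumes "0 < Im \<tau>" "0 < m" "norm \<sigma> = 1"
  shows "(\<lambda>j. norm (theta_coeff \<tau> \<sigma> m r j)) summable_on UNIV"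
    and "(\<lambda>j. norm (theta_coeff \<tau> \<sigma> m r j) * theta_rate m r j) summable_on UNIV"
proof -
  have n: "norm (theta_coeff \<tau> \<sigma> m r j) = \<bar>of_int j + r\<bar> ^ 1 * norm (qexp \<tau> (m * (of_int j + r)\<^sup>2))" for j
    unfolding theta_coeff_def norm_mult norm_of_real using assms by (simp add: norm_power_int)
  show "(\<lambda>j. norm (theta_coeff \<tau> \<sigma> m r j)) summable_on UNIV"
    unfolding n using assms by (intro summable_on_qexp)
  have "norm (theta_coeff \<tau> \<sigma> m r j) * theta_rate m r j =
      2 * pi * m * (\<bar>of_int j + r\<bar> ^ 3 * norm (qexp \<tau> (m * (of_int j + r)\<^sup>2)))" for j
  proof -
    have "(of_int j + r)\<^sup>2 = \<bar>of_int j + r\<bar>\<^sup>2" by simp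
    then show ?thesis
      unfolding n theta_rate_def by (simp only: power2_eq_square power3_eq_cube power_one_right mult_ac)
  qed
  then show "(\<lambda>j. norm (theta_coeff \<tau> \<sigma> m r j) * theta_rate m r j) summable_on UNIV"
    using assms by (simp only:) (intro summable_on_cmult_right summable_on_qexp)
qed

lemma theta_ray_has_vector_derivative:
  assumes "0 < Im \<tau>" "0 < m" "norm \<sigma> = 1" "0 \<le> s"
  shows "(theta_ray \<tau> \<sigma> m r has_vector_derivative theta_ray_deriv \<tau> \<sigma> m r s) (at s within {0..})"
proof -
  have "0 \<le> theta_rate m r j" for j using assms by (simp add: theta_rate_def)
  then show ?thesis
    unfolding theta_ray_def[abs_def] theta_ray_deriv_def
    using theta_coeff_summable[OF assms(1-3)] infinite_UNIV_int assms(4)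
    by (intro has_vector_derivative_infsum_exp) auto
qed

lemma theta_ray_deriv_continuous:
  assumes "0 < Im \<tau>" "0 < m" "norm \<sigma> = 1"
  shows "continuous_on {0..} (theta_ray_deriv \<tau> \<sigma> m r)"
  unfolding theta_ray_deriv_def[abs_def]
proof (rule continuous_on_infsum[OF _ _ theta_coeff_summable(2)[OF assms]])
  show "continuous_on {0..} (\<lambda>s. - (theta_coeff \<tau> \<sigma> m r j * of_real (theta_rate m r j)) *
      complex_of_real (exp (- theta_rate m r j * s)))" for j
    by (intro continuous_intros)
  fix j and s :: real assume "s \<in> {0..}"
  moreover have "0 \<le> theta_rate m r j" using assms by (simp add: theta_rate_def)
  ultimately show "norm (- (theta_coeff \<tau> \<sigma> m r j * of_real (theta_rate m r j)) *
      complex_of_real (exp (- theta_rate m r j * s))) \<le> norm (theta_coeff \<tau> \<sigma> m r j) * theta_rate m r j"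
    unfolding norm_mult norm_minus_cancel norm_of_real by (auto intro!: mult_left_le)
qed

text \<open>The density g = - 2 F' - c F of the integration by parts, for a single theta series in
  place of F.\<close>

definition theta_density :: "complex \<Rightarrow> complex \<Rightarrow> complex \<Rightarrow> real \<Rightarrow> real \<Rightarrow> real \<Rightarrow> complex" where
  "theta_density \<tau> c \<sigma> m r s = - 2 * theta_ray_deriv \<tau> \<sigma> m r s - c * theta_ray \<tau> \<sigma> m r s"

lemma theta_density_continuous:
  assumes "0 < Im \<tau>" "0 < m" "norm \<sigma> = 1"
  shows "continuous_on {0..} (theta_density \<tau> c \<sigma> m r)"
proof -
  have "continuous_on {0..} (theta_ray \<tau> \<sigma> m r)"
    by (rule continuous_on_vector_derivative[OF theta_ray_has_vector_derivative]) (use assms in auto)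
  then show ?thesis
    unfolding theta_density_def[abs_def]
    by (intro continuous_intros theta_ray_deriv_continuous assms)
qed

text \<open>The density is again an exponential series, so
  \<open>integral_exp_series_product\<close> applies; the rest identifies its terms. The factor 2 is
  the one in front of the regularized integral.\<close>

lemma theta_pair_integral:
  fixes \<tau> e :: complex
  assumes \<tau>: "0 < Im \<tau>" and m: "0 < m" and \<sigma>: "norm \<sigma> = 1"
    and \<epsilon>: "0 < \<epsilon>" "\<And>j::int. \<epsilon> \<le> \<bar>of_int j + r\<bar>" "\<And>j::int. \<epsilon> \<le> \<bar>of_int j + r'\<bar>"
  defines "h \<equiv> \<lambda>t. theta_ray \<tau> \<sigma> m r t * integral {0..1} (\<lambda>v. theta_density \<tau> (of_real pi * e / 6) \<sigma> m r' (t * v\<^sup>2))"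
  shows "set_integrable lborel {0<..} h"
    and "((\<lambda>(j, k). \<sigma> powi (j + k) * angle_term e m (of_int j + r) (of_int k + r')
      * qexp \<tau> (m * ((of_int j + r)\<^sup>2 + (of_int k + r')\<^sup>2))) has_sum 2 * (LBINT t:{0<..}. h t)) UNIV"
proof -
  define c where "c = of_real pi * e / 6"
  \<comment> \<open>Differentiating an exponential yields minus its rate, hence - 2 F' contributes
    plus twice the rate.\<close>
  define d where "d k = theta_coeff \<tau> \<sigma> m r' k * (of_real (2 * theta_rate m r' k) - c)" for k
  note sc = theta_coeff_summable[OF \<tau> m \<sigma>]
  have rate0: "0 \<le> theta_rate m r j" for r j using m by (simp add: theta_rate_def)
  have sd: "(\<lambda>k. norm (d k)) summable_on UNIV"
  proof (rule summable_on_comparison_test)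
    show "(\<lambda>k. 2 * (norm (theta_coeff \<tau> \<sigma> m r' k) * theta_rate m r' k) + norm (theta_coeff \<tau> \<sigma> m r' k) * norm c) summable_on UNIV"
      by (intro summable_on_add summable_on_cmult_right summable_on_cmult_left sc)
    fix k
    have "norm (of_real (2 * theta_rate m r' k) - c) \<le> 2 * theta_rate m r' k + norm c"
      by (rule order_trans[OF norm_triangle_ineq4]) (use rate0[of r' k] in simp)
    then show "norm (d k) \<le> 2 * (norm (theta_coeff \<tau> \<sigma> m r' k) * theta_rate m r' k) + norm (theta_coeff \<tau> \<sigma> m r' k) * norm c"
      unfolding d_def norm_mult using mult_left_mono[OF _ norm_ge_zero[of "theta_coeff \<tau> \<sigma> m r' k"]]
      by (fastforce simp: algebra_simps)
  qed auto
  have density: "theta_density \<tau> c \<sigma> m r' s = (\<Sum>\<^sub>\<infinity>k. d k * of_real (exp (- theta_rate m r' k * s)))" if "0 \<le> s" for s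
  proof -
    have ex: "norm (z * complex_of_real (exp (- theta_rate m r' k * s))) \<le> norm z" for z k
      unfolding norm_mult using that rate0[of r' k] by (intro mult_left_le) auto
    have s1: "(\<lambda>k. theta_coeff \<tau> \<sigma> m r' k * of_real (exp (- theta_rate m r' k * s))) summable_on UNIV"
      by (rule abs_summable_summable, rule summable_on_comparison_test[OF sc(1)]) (rule ex, simp)
    have s2: "(\<lambda>k. - (theta_coeff \<tau> \<sigma> m r' k * of_real (theta_rate m r' k)) * of_real (exp (- theta_rate m r' k * s))) summable_on UNIV"
    proof (rule abs_summable_summable, rule summable_on_comparison_test[OF sc(2)])
      show "norm (- (theta_coeff \<tau> \<sigma> m r' k * of_real (theta_rate m r' k)) * of_real (exp (- theta_rate m r' k * s)))
        \<le> norm (theta_coeff \<tau> \<sigma> m r' k) * theta_rate m r' k" for k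
        by (rule order_trans[OF ex]) (use rate0[of r' k] in \<open>simp add: norm_mult\<close>)
    qed simp
    have "((\<lambda>k. - 2 * (- (theta_coeff \<tau> \<sigma> m r' k * of_real (theta_rate m r' k)) * of_real (exp (- theta_rate m r' k * s)))
       + (- c) * (theta_coeff \<tau> \<sigma> m r' k * of_real (exp (- theta_rate m r' k * s)))) has_sum
        - 2 * theta_ray_deriv \<tau> \<sigma> m r' s + (- c) * theta_ray \<tau> \<sigma> m r' s) UNIV"
      unfolding theta_ray_def theta_ray_deriv_def
      by (intro has_sum_add has_sum_cmult_right has_sum_infsum s1 s2)
    moreover have "- 2 * (- (x * y) * z) + (- c) * (x * z) = x * (2 * y - c) * z" for x y z :: complex
      by (simp add: algebra_simps)
    ultimately show ?thesis
      unfolding theta_density_def by (simp add: d_def infsumI)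
  qed
  have rate: "2 * pi * m * \<epsilon>\<^sup>2 \<le> theta_rate m r j" "2 * pi * m * \<epsilon>\<^sup>2 \<le> theta_rate m r' j" for j
  proof -
    have "\<epsilon>\<^sup>2 \<le> (of_int j + r)\<^sup>2" "\<epsilon>\<^sup>2 \<le> (of_int j + r')\<^sup>2"
      using \<epsilon> by (simp_all add: abs_le_square_iff[symmetric])
    then show "2 * pi * m * \<epsilon>\<^sup>2 \<le> theta_rate m r j" "2 * pi * m * \<epsilon>\<^sup>2 \<le> theta_rate m r' j"
      unfolding theta_rate_def using m by (auto intro!: mult_left_mono)
  qed
  have \<epsilon>': "0 < 2 * pi * m * \<epsilon>\<^sup>2" using m \<epsilon>(1) by simp
  define h' where "h' t = (\<Sum>\<^sub>\<infinity>j. theta_coeff \<tau> \<sigma> m r j * of_real (exp (- theta_rate m r j * t))) *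
     integral {0..1} (\<lambda>v. \<Sum>\<^sub>\<infinity>k. d k * of_real (exp (- theta_rate m r' k * (t * v\<^sup>2))))" for t
  note I = integral_exp_series_product[where \<gamma> = "theta_rate m r" and \<delta> = "theta_rate m r'",
      OF \<epsilon>' rate sc(1)[of r] sd, folded h'_def]
  have hh': "h t = h' t" if "t \<in> {0<..}" for t
    unfolding h_def h'_def theta_ray_def[symmetric] c_def[symmetric]
    using that by (intro arg_cong2[of _ _ _ _ "(*)"] refl integral_cong density) simp
  show "set_integrable lborel {0<..} h"
  proof -
    have "set_integrable lborel {0<..} h = set_integrable lborel {0<..} h'"
      by (rule set_integrable_cong[OF refl refl]) (use hh' in auto)
    then show ?thesis using I(1) by simp
  qed
  have hint: "(LBINT t:{0<..}. h t) = (LBINT t:{0<..}. h' t)"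
    using hh' by (intro set_lebesgue_integral_cong) auto
  have "((\<lambda>p. 2 * (case p of (j, k) \<Rightarrow> theta_coeff \<tau> \<sigma> m r j * d k * of_real
      (arctan (sqrt (theta_rate m r' k / theta_rate m r j)) / sqrt (theta_rate m r j * theta_rate m r' k))))
      has_sum 2 * (LBINT t:{0<..}. h t)) UNIV"
    unfolding hint I(2) by (rule has_sum_cmult_right[OF has_sum_infsum[OF abs_summable_summable[OF I(3)]]])
  moreover have "2 * (case p of (j, k) \<Rightarrow> theta_coeff \<tau> \<sigma> m r j * d k * of_real
      (arctan (sqrt (theta_rate m r' k / theta_rate m r j)) / sqrt (theta_rate m r j * theta_rate m r' k))) =
    (case p of (j, k) \<Rightarrow> \<sigma> powi (j + k) * angle_term e m (of_int j + r) (of_int k + r')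
      * qexp \<tau> (m * ((of_int j + r)\<^sup>2 + (of_int k + r')\<^sup>2)))" for p :: "int \<times> int"
  proof -
    obtain j k where p: "p = (j, k)" by force
    define x y where "x = of_int j + r" and "y = of_int k + r'"
    have ne: "x \<noteq> 0" "y \<noteq> 0" using \<epsilon>(1) \<epsilon>(2)[of j] \<epsilon>(3)[of k] by (auto simp: x_def y_def)
    have r1: "sqrt (theta_rate m r' k / theta_rate m r j) = \<bar>y / x\<bar>"
      using m by (simp add: theta_rate_def x_def y_def real_sqrt_divide real_sqrt_mult)
    have r2: "sqrt (theta_rate m r j * theta_rate m r' k) = 2 * pi * m * \<bar>x * y\<bar>"
    proof -
      have "theta_rate m r j * theta_rate m r' k = (2 * pi * m * (x * y))\<^sup>2"
        by (simp add: theta_rate_def x_def y_def power2_eq_square)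
      then show ?thesis using m by (simp add: abs_mult)
    qed
    have \<sigma>0: "\<sigma> \<noteq> 0" using \<sigma> by auto
    \<comment> \<open>The linear factors x and y of the two theta coefficients cancel against the
      square root of the product of the rates and leave only their sign.\<close>
    have sg: "of_real x * of_real y * complex_of_real (a / (2 * pi * m * \<bar>x * y\<bar>)) = of_real (sgn (x * y) * a) / of_real (2 * pi * m)" for a
    proof -
      have "x * y * (a / (2 * pi * m * \<bar>x * y\<bar>)) = sgn (x * y) * a / (2 * pi * m)"
        using m ne by (simp add: sgn_if field_simps)
      then show ?thesis by (simp flip: of_real_mult of_real_divide)
    qed
    \<comment> \<open>Division by 2 pi m turns pi e / 6 into the E2 term: 6 m is 18 for m = 3 and 9
      for m = 3/2, the constants in \<open>f_angle\<close> and \<open>g_angle\<close>.\<close>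
    have co: "2 * (of_real (2 * (2 * pi * m * y\<^sup>2)) - of_real pi * e / 6) / complex_of_real (2 * pi * m) =
       4 * of_real (y\<^sup>2) - e / of_real (6 * m)"
      using m by (simp add: field_simps)
    let ?a = "arctan \<bar>y / x\<bar>" and ?f = "of_real (2 * (2 * pi * m * y\<^sup>2)) - of_real pi * e / 6 :: complex"
    have "2 * (theta_coeff \<tau> \<sigma> m r j * d k * of_real (?a / (2 * pi * m * \<bar>x * y\<bar>))) =
       (\<sigma> powi j * \<sigma> powi k) * (qexp \<tau> (m * x\<^sup>2) * qexp \<tau> (m * y\<^sup>2)) *
       (of_real x * of_real y * complex_of_real (?a / (2 * pi * m * \<bar>x * y\<bar>))) * (2 * ?f)"
      unfolding theta_coeff_def d_def c_def theta_rate_def x_def[symmetric] y_def[symmetric]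
      by (simp only: mult_ac)
    also have "\<dots> = \<sigma> powi (j + k) * qexp \<tau> (m * (x\<^sup>2 + y\<^sup>2)) * of_real (sgn (x * y) * ?a) * (2 * ?f / of_real (2 * pi * m))"
      unfolding sg using \<sigma>0 by (simp add: power_int_add qexp_add distrib_left)
    finally show ?thesis
      unfolding p prod.case r1 r2 x_def[symmetric] y_def[symmetric] angle_term_def co
      by (simp only: mult_ac)
  qed
  ultimately show "((\<lambda>(j, k). \<sigma> powi (j + k) * angle_term e m (of_int j + r) (of_int k + r')
      * qexp \<tau> (m * ((of_int j + r)\<^sup>2 + (of_int k + r')\<^sup>2))) has_sum 2 * (LBINT t:{0<..}. h t)) UNIV"
    by (simp only:)
qed

section \<open>The outer integral as a combination of four theta pair integrals\<close>

theorem proposition6p6: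
  fixes \<tau> :: complex
  assumes "Im \<tau> > 0"
  shows "(\<forall>t>0. reg_integrable \<tau> (inner_fun \<tau> (\<tau> + \<i> * complex_of_real t)) (\<tau> + \<i> * complex_of_real t)) \<and>
         vertical_integrable \<tau> (outer_fun \<tau>) \<and>
         Phi \<tau> = 1 / of_real pi * vertical_integral \<tau> (outer_fun \<tau>)"
proof -
  define c where "c = of_real pi * E2 \<tau> / 6"
  define T1 T2 T3 T4 where "T1 = theta_ray \<tau> 1 3 (1/6)" and "T2 = theta_ray \<tau> 1 3 (1/3)"
    and "T3 = theta_ray \<tau> (- 1) (3/2) (5/6)" and "T4 = theta_ray \<tau> (- 1) (3/2) (1/2)"
  define T1' T2' T3' T4' where "T1' = theta_ray_deriv \<tau> 1 3 (1/6)" and "T2' = theta_ray_deriv \<tau> 1 3 (1/3)"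
    and "T3' = theta_ray_deriv \<tau> (- 1) (3/2) (5/6)" and "T4' = theta_ray_deriv \<tau> (- 1) (3/2) (1/2)"
  define G1 G2 G3 G4 where "G1 = theta_density \<tau> c 1 3 (1/6)" and "G2 = theta_density \<tau> c 1 3 (1/3)"
    and "G3 = theta_density \<tau> c (- 1) (3/2) (5/6)" and "G4 = theta_density \<tau> c (- 1) (3/2) (1/2)"
  note Ts = T1_def T2_def T3_def T4_def
  note T's = T1'_def T2'_def T3'_def T4'_def
  note Gs = G1_def G2_def G3_def G4_def
  define I where "I G t = integral {0..1} (\<lambda>v. G (t * v\<^sup>2))" for G :: "real \<Rightarrow> complex" and t :: real
  \<comment> \<open>The regularized integral is 2 sqrt t \<open>H t\<close>; dividing by the root i
    sqrt t and multiplying by the i of dw leaves 2 \<open>H t\<close>.\<close>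
  define H where "H t = 4 * (T1 t * I G2 t) - 4 * (T2 t * I G1 t) + (T3 t * I G4 t - T4 t * I G3 t)" for t
  have Tder: "(T1 has_vector_derivative T1' s) (at s within {0..})" "(T2 has_vector_derivative T2' s) (at s within {0..})"
    "(T3 has_vector_derivative T3' s) (at s within {0..})" "(T4 has_vector_derivative T4' s) (at s within {0..})"
    if "0 \<le> s" for s
    unfolding Ts T's by (rule theta_ray_has_vector_derivative; use assms that in simp)+
  have T'cont: "continuous_on {0..} T1'" "continuous_on {0..} T2'" "continuous_on {0..} T3'" "continuous_on {0..} T4'"
    unfolding T's by (rule theta_ray_deriv_continuous; use assms in simp)+
  have Gcont: "continuous_on {0..} G1" "continuous_on {0..} G2" "continuous_on {0..} G3" "continuous_on {0..} G4"
    unfolding Gs by (rule theta_density_continuous; use assms in simp)+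
  have reg: "reg_integrable \<tau> (inner_fun \<tau> (\<tau> + \<i> * of_real t)) (\<tau> + \<i> * of_real t)"
    and outer: "outer_fun \<tau> (\<tau> + \<i> * of_real t) * \<i> = 2 * H t" if t: "0 < t" for t
  proof -
    define F where "F s = 4 * (T1 t * T2 s - T2 t * T1 s) + (T3 t * T4 s - T4 t * T3 s)" for s
    define F' where "F' s = 4 * (T1 t * T2' s - T2 t * T1' s) + (T3 t * T4' s - T4 t * T3' s)" for s
    have inner: "inner_fun \<tau> (\<tau> + \<i> * of_real t) (\<tau> + \<i> * of_real s) = F s * (1 + c * of_real s)" for s
      unfolding inner_fun_def f0_def g0_def theta_eq_theta_ray F_def Ts c_def by (simp add: field_simps)
    have Fder: "(F has_vector_derivative F' s) (at s within {0..})" if "0 \<le> s" for s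
      unfolding F_def F'_def
      by (intro has_vector_derivative_add has_vector_derivative_diff has_vector_derivative_mult_right Tder that)
    have F'cont: "continuous_on {0..} F'"
      unfolding F'_def by (intro continuous_intros T'cont)
    \<comment> \<open>Antisymmetry of \<open>f0\<close> and \<open>g0\<close> on the diagonal; this
      is what makes the boundary term vanish.\<close>
    have Ft: "F t = 0" by (simp add: F_def)
    note R = reg_integral_vertical[where c = c, OF t inner Fder F'cont Ft]
    show "reg_integrable \<tau> (inner_fun \<tau> (\<tau> + \<i> * of_real t)) (\<tau> + \<i> * of_real t)"
      by (rule R(1))
    have hi: "((\<lambda>v. G (t * v\<^sup>2)) has_integral I G t) {0..1}" if "continuous_on {0..} G" for G
    proof -
      have "continuous_on {0..1} (\<lambda>v. G (t * v\<^sup>2))"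
        by (rule continuous_on_compose2[OF that]) (use t in \<open>auto intro!: continuous_intros\<close>)
      then show ?thesis
        unfolding I_def by (intro integrable_integral integrable_continuous_real)
    qed
    have "((\<lambda>v. 4 * (T1 t * G2 (t * v\<^sup>2)) - 4 * (T2 t * G1 (t * v\<^sup>2)) + (T3 t * G4 (t * v\<^sup>2) - T4 t * G3 (t * v\<^sup>2)))
        has_integral H t) {0..1}"
      unfolding H_def
      by (intro has_integral_add has_integral_diff has_integral_mult_right hi Gcont)
    moreover have "4 * (T1 t * G2 s) - 4 * (T2 t * G1 s) + (T3 t * G4 s - T4 t * G3 s) = - 2 * F' s - c * F s" for s
      unfolding Gs theta_density_def Ts[symmetric] T's[symmetric] F_def F'_def by (simp add: algebra_simps)
    ultimately have "integral {0..1} (\<lambda>v. - 2 * F' (t * v\<^sup>2) - c * F (t * v\<^sup>2)) = H t"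
      by (simp only: integral_unique)
    then have "reg_integral \<tau> (inner_fun \<tau> (\<tau> + \<i> * of_real t)) (\<tau> + \<i> * of_real t) = 2 * of_real (sqrt t) * H t"
      using R(2) by simp
    then show "outer_fun \<tau> (\<tau> + \<i> * of_real t) * \<i> = 2 * H t"
      using t by (simp add: outer_fun_def csqrt_i_vertical field_simps)
  qed
  \<comment> \<open>All four shifts have distance at least 1/6 from the integers, which keeps the
    rates away from 0.\<close>
  have sixth: "(1 / 6 :: real) \<le> \<bar>of_int j + 1/6\<bar>" "(1 / 6 :: real) \<le> \<bar>of_int j + 1/3\<bar>"
    "(1 / 6 :: real) \<le> \<bar>of_int j + 1/2\<bar>" "(1 / 6 :: real) \<le> \<bar>of_int j + 5/6\<bar>" for j :: int
  proof -
    have "j \<ge> 0 \<or> j \<le> - 1" by linarith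
    then have "real_of_int j \<ge> 0 \<or> real_of_int j \<le> - 1" by linarith
    then show "(1 / 6 :: real) \<le> \<bar>of_int j + 1/6\<bar>" "(1 / 6 :: real) \<le> \<bar>of_int j + 1/3\<bar>"
      "(1 / 6 :: real) \<le> \<bar>of_int j + 1/2\<bar>" "(1 / 6 :: real) \<le> \<bar>of_int j + 5/6\<bar>"
      by linarith+
  qed
  note pair = theta_pair_integral[OF assms, where \<epsilon> = "1/6" and e = "E2 \<tau>", folded c_def]
  note pair3 = pair[of 3 1] and pair32 = pair[of "3/2" "- 1"]
  have P12: "set_integrable lborel {0<..} (\<lambda>t. T1 t * I G2 t)"
    "((\<lambda>(j, k). angle_term (E2 \<tau>) 3 (of_int j + 1/6) (of_int k + 1/3)
      * qexp \<tau> (3 * ((of_int j + 1/6)\<^sup>2 + (of_int k + 1/3)\<^sup>2))) has_sum 2 * (LBINT t:{0<..}. T1 t * I G2 t)) UNIV"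
    using pair3[of "1/6" "1/3", OF _ _ _ sixth(1,2)] unfolding Ts Gs I_def by simp_all
  have P21: "set_integrable lborel {0<..} (\<lambda>t. T2 t * I G1 t)"
    "((\<lambda>(j, k). angle_term (E2 \<tau>) 3 (of_int j + 1/3) (of_int k + 1/6)
      * qexp \<tau> (3 * ((of_int j + 1/3)\<^sup>2 + (of_int k + 1/6)\<^sup>2))) has_sum 2 * (LBINT t:{0<..}. T2 t * I G1 t)) UNIV"
    using pair3[of "1/3" "1/6", OF _ _ _ sixth(2,1)] unfolding Ts Gs I_def by simp_all
  have P34: "set_integrable lborel {0<..} (\<lambda>t. T3 t * I G4 t)"
    "((\<lambda>(j, k). (- 1) powi (j + k) * angle_term (E2 \<tau>) (3/2) (of_int j + 5/6) (of_int k + 1/2)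
      * qexp \<tau> (3/2 * ((of_int j + 5/6)\<^sup>2 + (of_int k + 1/2)\<^sup>2))) has_sum 2 * (LBINT t:{0<..}. T3 t * I G4 t)) UNIV"
    unfolding Ts Gs I_def by (rule pair32[of "5/6" "1/2", OF _ _ _ sixth(4,3)]; simp)+
  have P43: "set_integrable lborel {0<..} (\<lambda>t. T4 t * I G3 t)"
    "((\<lambda>(j, k). (- 1) powi (j + k) * angle_term (E2 \<tau>) (3/2) (of_int j + 1/2) (of_int k + 5/6)
      * qexp \<tau> (3/2 * ((of_int j + 1/2)\<^sup>2 + (of_int k + 5/6)\<^sup>2))) has_sum 2 * (LBINT t:{0<..}. T4 t * I G3 t)) UNIV"
    unfolding Ts Gs I_def by (rule pair32[of "1/2" "5/6", OF _ _ _ sixth(3,4)]; simp)+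
  let ?L = "\<lambda>h. LBINT t:{0<..}. h t"
  have H: "set_integrable lborel {0<..} H"
    unfolding H_def by (intro set_integral_add set_integral_diff set_integrable_mult_right P12 P21 P34 P43)
  have LH: "?L H = 4 * ?L (\<lambda>t. T1 t * I G2 t) - 4 * ?L (\<lambda>t. T2 t * I G1 t)
      + (?L (\<lambda>t. T3 t * I G4 t) - ?L (\<lambda>t. T4 t * I G3 t))"
    unfolding H_def by (simp add: set_integral_add set_integral_diff P12(1) P21(1) P34(1) P43(1))
  have "vertical_integrable \<tau> (outer_fun \<tau>) \<longleftrightarrow> set_integrable lborel {0<..} (\<lambda>t. 2 * H t)"
    unfolding vertical_integrable_def by (rule set_integrable_cong[OF refl refl]) (use outer in auto)
  then have vi: "vertical_integrable \<tau> (outer_fun \<tau>)"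
    using H by simp
  have "vertical_integral \<tau> (outer_fun \<tau>) = ?L (\<lambda>t. 2 * H t)"
    unfolding vertical_integral_def by (rule set_lebesgue_integral_cong) (use outer in auto)
  \<comment> \<open>Each factor 2 is attached to one pair integral, so that the expression has the
    form (4 x - 4 y) + (x' - y') of the lattice sums of \<open>f_angle\<close> and
    \<open>g_angle\<close>.\<close>
  also have "\<dots> = (4 * (2 * ?L (\<lambda>t. T1 t * I G2 t)) - 4 * (2 * ?L (\<lambda>t. T2 t * I G1 t)))
      + (2 * ?L (\<lambda>t. T3 t * I G4 t) - 2 * ?L (\<lambda>t. T4 t * I G3 t))"
    by (simp add: LH)
  also have "\<dots> = of_real pi * Phi \<tau>"
    using Phi_eq_angle_sums[OF assms f_angle_has_sum[OF P12(2) P21(2)] g_angle_has_sum[OF P34(2) P43(2)]] .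
  finally show ?thesis
    using reg vi by simp
qed

end
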